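(* There exists a universal constant $C>0$ such that for every dimension $d\in\mathbb{N}$ and every $f\in H^1((0,1)^d)$, \[ \mathsf{dist}^{\mathsf{mono}}_2(f)^2 \le C \int_{(0,1)^d} \|\nabla^- f(x)\|_2^2 \, dx . \]
   Context: $H^1((0,1)^d)$ is the Sobolev space of $L^2$ functions with weak first derivatives in $L^2$. For $x,y\in\mathbb{R}^d$, $x\preceq y$ means $x_i\le y_i$ for all $i$; a function $g$ on $(0,1)^d$ is monotone if $g(x)\le g(y)$ whenever $x\preceq y$ (for elements of $L^2$: if it has such a representative). $\mathsf{dist}^{\mathsf{mono}}_2(f)=\inf\{\|f-g\|_{L^2((0,1)^d)} : g\in L^2((0,1)^d) \text{ monotone}\}$, with Lebesgue measure on the cube. The directed gradient is $\nabla^- f=(\partial_1^- f,\dots,\partial_d^- f)$ where $\partial_i^- f=\min\{0,\partial_i f\}$ and $\partial_i f$ is the weak partial derivative. *)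

theory Defs
  imports "HOL-Analysis.Analysis"
begin

text \<open>
  The dimension is quantified inside the statement (the constant must not depend on it), so
  points of \<open>\<real>\<^sup>d\<close> are functions on \<open>{..<d}\<close>, extended by \<^term>\<open>undefined\<close> to
  all of \<^typ>\<open>nat\<close>. On such functions the product topology and the pointwise order of
  \<^typ>\<open>nat \<Rightarrow> real\<close> are the usual ones of \<open>\<real>\<^sup>d\<close>. All functions on the cube are
  considered on \<open>cube d\<close> only; their values elsewhere are irrelevant.
\<close>

definition cube :: "nat \<Rightarrow> (nat \<Rightarrow> real) set" where
  "cube d = ({..<d} \<rightarrow>\<^sub>E {0<..<1})"

text \<open>The completion makes this Lebesgue (rather than Borel) measure.\<close>

definition cube_measure :: "nat \<Rightarrow> (nat \<Rightarrow> real) measure" where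
  "cube_measure d = completion (\<Pi>\<^sub>M i\<in>{..<d}. restrict_space lborel {0<..<1})"

definition L2 :: "nat \<Rightarrow> ((nat \<Rightarrow> real) \<Rightarrow> real) set" where
  "L2 d = {f \<in> borel_measurable (cube_measure d). integrable (cube_measure d) (\<lambda>x. (f x)\<^sup>2)}"

definition L2_norm :: "nat \<Rightarrow> ((nat \<Rightarrow> real) \<Rightarrow> real) \<Rightarrow> real" where
  "L2_norm d f = sqrt (\<integral>x. (f x)\<^sup>2 \<partial>cube_measure d)"

definition partial :: "nat \<Rightarrow> ((nat \<Rightarrow> real) \<Rightarrow> real) \<Rightarrow> (nat \<Rightarrow> real) \<Rightarrow> real" where
  "partial i \<phi> x = deriv (\<lambda>t. \<phi> (x(i := t))) (x i)"

text \<open>Partial derivatives of all orders exist and are continuous; \<open>is\<close> is a multi-index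
  written as a list of coordinates.\<close>

definition smooth_on_cube :: "nat \<Rightarrow> ((nat \<Rightarrow> real) \<Rightarrow> real) \<Rightarrow> bool" where
  "smooth_on_cube d \<phi> \<longleftrightarrow>
     (\<forall>is \<in> lists {..<d}.
        continuous_on (cube d) (foldr partial is \<phi>) \<and>
        (\<forall>i<d. \<forall>x\<in>cube d. (\<lambda>t. foldr partial is \<phi> (x(i := t))) differentiable (at (x i))))"

definition test_functions :: "nat \<Rightarrow> ((nat \<Rightarrow> real) \<Rightarrow> real) set" where
  "test_functions d = {\<phi>. smooth_on_cube d \<phi> \<and>
     compact (closure {x \<in> cube d. \<phi> x \<noteq> 0}) \<and> closure {x \<in> cube d. \<phi> x \<noteq> 0} \<subseteq> cube d}"

definition has_weak_partial ::
  "nat \<Rightarrow> nat \<Rightarrow> ((nat \<Rightarrow> real) \<Rightarrow> real) \<Rightarrow> ((nat \<Rightarrow> real) \<Rightarrow> real) \<Rightarrow> bool" where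
  "has_weak_partial d i f g \<longleftrightarrow>
     (\<forall>\<phi> \<in> test_functions d.
        (\<integral>x. f x * partial i \<phi> x \<partial>cube_measure d) = - (\<integral>x. g x * \<phi> x \<partial>cube_measure d))"

definition H1 :: "nat \<Rightarrow> ((nat \<Rightarrow> real) \<Rightarrow> real) set" where
  "H1 d = {f \<in> L2 d. \<forall>i<d. \<exists>g \<in> L2 d. has_weak_partial d i f g}"

text \<open>Weak derivatives are unique up to null sets, so the choice of representative is immaterial.\<close>

definition weak_partial :: "nat \<Rightarrow> nat \<Rightarrow> ((nat \<Rightarrow> real) \<Rightarrow> real) \<Rightarrow> (nat \<Rightarrow> real) \<Rightarrow> real" where
  "weak_partial d i f = (SOME g. g \<in> L2 d \<and> has_weak_partial d i f g)"

definition directed_gradient ::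
  "nat \<Rightarrow> ((nat \<Rightarrow> real) \<Rightarrow> real) \<Rightarrow> (nat \<Rightarrow> real) \<Rightarrow> nat \<Rightarrow> real" where
  "directed_gradient d f x i = min 0 (weak_partial d i f x)"

definition monotone_L2 :: "nat \<Rightarrow> ((nat \<Rightarrow> real) \<Rightarrow> real) set" where
  "monotone_L2 d =
     {g \<in> L2 d. \<exists>h. mono_on (cube d) h \<and> (AE x in cube_measure d. g x = h x)}"

definition dist_mono :: "nat \<Rightarrow> ((nat \<Rightarrow> real) \<Rightarrow> real) \<Rightarrow> real" where
  "dist_mono d f = (INF g \<in> monotone_L2 d. L2_norm d (\<lambda>x. f x - g x))"

end

theory Submission
  imports Defs "HOL-Probability.Probability" "HOL-Real_Asymp.Real_Asymp"
begin

text \<open>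
  Monotone functions are the zero set of the convex functional
  \<open>\<Phi> u = \<Sum>\<^sub>i \<integral> (min 0 (\<partial>\<^sub>i u))\<^sup>2\<close>, so it suffices that its gradient is large wherever \<open>\<Phi>\<close> is:
  if \<open>\<parallel>\<nabla>\<Phi>\<parallel>\<^sup>2 \<ge> c \<Phi>\<close>, then descending along \<open>-\<nabla>\<Phi>\<close> reaches the zero set within distance
  \<open>O(\<surd>\<Phi>)\<close>. The component of the gradient in direction \<open>i\<close> satisfies such a bound by the
  one-dimensional Poincare inequality, since \<open>min 0 (\<partial>\<^sub>i u)\<close> vanishes at the boundary. These bounds
  add up without loss in the dimension because the components have nonnegative inner
  products: integrating by parts twice turns the inner product for \<open>i \<noteq> j\<close> into
  \<open>\<integral> \<partial>\<^sub>j (min 0 (\<partial>\<^sub>i u)) * \<partial>\<^sub>i (min 0 (\<partial>\<^sub>j u))\<close>, where both factors have the sign of \<open>\<partial>\<^sub>i\<partial>\<^sub>j u\<close>.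

  The argument is carried out on a grid of mesh \<open>1 / n\<close>, where the descent is replaced by a
  compactness argument, and applied to the cell averages of \<open>f\<close>. Their discrete directed energy is
  controlled by that of \<open>f\<close>: the difference of the averages over two adjacent cells is an integral of
  the weak derivative against a tent function.
\<close>

section \<open>The inequality on a grid\<close>

definition grid :: "nat \<Rightarrow> nat \<Rightarrow> (nat \<Rightarrow> nat) set" where
  "grid d n = ({..<d} \<rightarrow>\<^sub>E {..<n})"

text \<open>The difference is not divided by the mesh, which accounts for the factors
  \<open>(real n)\<^sup>2\<close> further on. The default 0 on the last layer means that no slope is
  measured across the upper face.\<close>

definition fwd :: "nat \<Rightarrow> nat \<Rightarrow> ((nat \<Rightarrow> nat) \<Rightarrow> real) \<Rightarrow> (nat \<Rightarrow> nat) \<Rightarrow> real" where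
  "fwd n i u q = (if Suc (q i) < n then u (q(i := Suc (q i))) - u q else 0)"

text \<open>The adjoint of \<open>fwd\<close>, that is, minus the backward difference, with
  \<open>w\<close> continued by 0 below the lower face.\<close>

definition bwd :: "nat \<Rightarrow> ((nat \<Rightarrow> nat) \<Rightarrow> real) \<Rightarrow> (nat \<Rightarrow> nat) \<Rightarrow> real" where
  "bwd i w q = (if q i = 0 then 0 else w (q(i := q i - 1))) - w q"

definition vio :: "nat \<Rightarrow> nat \<Rightarrow> ((nat \<Rightarrow> nat) \<Rightarrow> real) \<Rightarrow> (nat \<Rightarrow> nat) \<Rightarrow> real" where
  "vio n i u q = min 0 (fwd n i u q)"

definition energy :: "nat \<Rightarrow> nat \<Rightarrow> ((nat \<Rightarrow> nat) \<Rightarrow> real) \<Rightarrow> real" where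
  "energy d n u = (\<Sum>i<d. \<Sum>q\<in>grid d n. (vio n i u q)\<^sup>2)"

lemma finite_grid [simp]: "finite (grid d n)"
  by (simp add: grid_def finite_PiE)

lemma grid_lt: "q \<in> grid d n \<Longrightarrow> i < d \<Longrightarrow> q i < n"
  by (auto simp: grid_def PiE_iff)

lemma grid_upd: "q \<in> grid d n \<Longrightarrow> i < d \<Longrightarrow> k < n \<Longrightarrow> q(i := k) \<in> grid d n"
  by (auto simp: grid_def PiE_iff extensional_def)

text \<open>Stepping up in direction \<open>i\<close> maps the cells off the last layer bijectively
  onto the cells off the first. The terms \<open>w q * p q\<close> left over on the last layer
  vanish by the hypothesis on \<open>w\<close>.\<close>

lemma sum_by_parts:
  assumes i: "i < d" and w: "\<And>q. \<not> Suc (q i) < n \<Longrightarrow> w q = 0"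
  shows "(\<Sum>q\<in>grid d n. w q * fwd n i p q) = (\<Sum>q\<in>grid d n. bwd i w q * p q)"
proof -
  let ?U = "{q \<in> grid d n. Suc (q i) < n}" and ?L = "{q \<in> grid d n. q i \<noteq> 0}"
  have "(\<Sum>q\<in>?U. w q * p (q(i := Suc (q i)))) = (\<Sum>q\<in>?L. w (q(i := q i - 1)) * p q)"
    by (rule sum.reindex_bij_witness[where i = "\<lambda>q. q(i := q i - 1)" and j = "\<lambda>q. q(i := Suc (q i))"])
       (use i grid_lt[OF _ i] in \<open>auto intro!: grid_upd[OF _ i] dest: grid_lt[OF _ i]\<close>)
  moreover have "(\<Sum>q\<in>grid d n. w q * fwd n i p q)
      = (\<Sum>q\<in>grid d n. (if Suc (q i) < n then w q * p (q(i := Suc (q i))) else 0) - w q * p q)"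
    by (rule sum.cong) (auto simp: fwd_def algebra_simps w)
  moreover have "(\<Sum>q\<in>grid d n. bwd i w q * p q)
      = (\<Sum>q\<in>grid d n. (if q i \<noteq> 0 then w (q(i := q i - 1)) * p q else 0) - w q * p q)"
    by (rule sum.cong) (auto simp: bwd_def algebra_simps)
  ultimately show ?thesis
    by (simp add: sum_subtractf sum.If_cases Int_def)
qed

text \<open>Translations in distinct directions commute, and each boundary case depends only on its
  own coordinate.\<close>

lemma fwd_bwd_commute:
  assumes "i \<noteq> j" shows "fwd n i (bwd j w) = bwd j (fwd n i w)"
  using assms by (auto simp: fwd_def bwd_def fun_eq_iff fun_upd_twist)

lemma vio_boundary: "\<not> Suc (q i) < n \<Longrightarrow> vio n i u q = 0"
  by (simp add: vio_def fwd_def)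

text \<open>Both mixed differences of the truncated slopes around a unit square have the sign of the
  mixed difference of \<open>u\<close>, because \<open>min 0\<close> is monotone.\<close>

lemma mixed_nonneg:
  assumes "i \<noteq> j" shows "fwd n i (vio n j u) q * fwd n j (vio n i u) q \<ge> 0"
proof (cases "Suc (q i) < n \<and> Suc (q j) < n")
  case True
  define a b c e where "a = u q" "b = u (q(i := Suc (q i)))" "c = u (q(j := Suc (q j)))"
    "e = u (q(i := Suc (q i), j := Suc (q j)))"
  have "fwd n i (vio n j u) q = min 0 (e - b) - min 0 (c - a)"
    "fwd n j (vio n i u) q = min 0 (e - c) - min 0 (b - a)"
    using True assms by (auto simp: fwd_def vio_def a_b_c_e_def fun_upd_twist)
  moreover have "(min 0 (e - b) - min 0 (c - a)) * (min 0 (e - c) - min 0 (b - a)) \<ge> 0"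
    by (cases "e - b \<ge> c - a") (auto simp: min_def intro!: mult_nonneg_nonneg mult_nonpos_nonpos)
  ultimately show ?thesis by simp
qed (use assms in \<open>auto simp: fwd_def vio_def\<close>)

text \<open>Moving \<open>bwd i\<close> and then \<open>bwd j\<close> across the sum leaves a
  product of two mixed forward differences, whose sign is given pointwise by
  \<open>mixed_nonneg\<close>.\<close>

lemma cross_nonneg:
  assumes ij: "i < d" "j < d" "i \<noteq> j"
  shows "(\<Sum>q\<in>grid d n. bwd i (vio n i u) q * bwd j (vio n j u) q) \<ge> 0"
proof -
  have "(\<Sum>q\<in>grid d n. bwd i (vio n i u) q * bwd j (vio n j u) q)
      = (\<Sum>q\<in>grid d n. vio n i u q * fwd n i (bwd j (vio n j u)) q)"
    by (rule sum_by_parts[OF ij(1) vio_boundary, symmetric])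
  also have "\<dots> = (\<Sum>q\<in>grid d n. bwd j (fwd n i (vio n j u)) q * vio n i u q)"
    by (simp add: fwd_bwd_commute[OF ij(3)] mult.commute)
  also have "\<dots> = (\<Sum>q\<in>grid d n. fwd n i (vio n j u) q * fwd n j (vio n i u) q)"
    \<comment> \<open>The weight vanishes on the last layer in direction \<open>j\<close>, because
      there \<open>vio n j u\<close> vanishes at both points of the difference in direction
      \<open>i\<close>.\<close>
    by (rule sum_by_parts[symmetric]) (use ij in \<open>auto simp: fwd_def vio_boundary\<close>)
  also have "\<dots> \<ge> 0" by (intro sum_nonneg mixed_nonneg ij)
  finally show ?thesis .
qed

text \<open>The value of \<open>w\<close> is minus the telescoping sum of \<open>bwd i w\<close>
  from the lower face, below which \<open>w\<close> is continued by 0. Cauchy-Schwarz along this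
  line costs one factor \<open>n\<close>, and summing over the line costs another.\<close>

lemma discrete_poincare:
  assumes i: "i < d"
  shows "(\<Sum>q\<in>grid d n. (w q)\<^sup>2) \<le> (real n)\<^sup>2 * (\<Sum>q\<in>grid d n. (bwd i w q)\<^sup>2)"
proof -
  define h where "h q = (bwd i w q)\<^sup>2" for q
  have pt: "(w q)\<^sup>2 \<le> n * (\<Sum>k<n. h (q(i := k)))" if q: "q \<in> grid d n" for q
  proof -
    have upd: "bwd i w (q(i := k)) = (if k = 0 then 0 else w (q(i := k - 1))) - w (q(i := k))" for k
      by (simp add: bwd_def)
    have tel: "(\<Sum>k<Suc m. bwd i w (q(i := k))) = - w (q(i := m))" for m
    proof (induction m)
      case 0
      have "bwd i w (q(i := 0)) = - w (q(i := 0))" by (simp add: upd)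
      then show ?case by (simp only: sum.lessThan_Suc lessThan_0 sum.empty add_0)
    next
      case (Suc m)
      have "bwd i w (q(i := Suc m)) = w (q(i := m)) - w (q(i := Suc m))" by (simp add: upd)
      then show ?case using Suc.IH by (simp only: sum.lessThan_Suc)
    qed
    have "(\<Sum>k<Suc (q i). bwd i w (q(i := k))) = - w q" using tel[of "q i"] by (simp only: fun_upd_triv)
    then have "(w q)\<^sup>2 = (\<Sum>k<Suc (q i). bwd i w (q(i := k)))\<^sup>2" by (simp only: power2_minus)
    also have "\<dots> \<le> real (Suc (q i)) * (\<Sum>k<Suc (q i). h (q(i := k)))"
      using sum_squared_le_sum_of_squares[of "\<lambda>k. bwd i w (q(i := k))" "{..<Suc (q i)}"]
      by (simp only: h_def mult.commute card_lessThan)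
    also have "\<dots> \<le> n * (\<Sum>k<n. h (q(i := k)))"
      using grid_lt[OF q i] by (intro mult_mono sum_mono2) (auto simp: h_def sum_nonneg)
    finally show ?thesis .
  qed
  have "(\<Sum>q\<in>grid d n. \<Sum>k<n. h (q(i := k))) = (\<Sum>(q,k)\<in>grid d n \<times> {..<n}. h (q(i := k)))"
    by (simp add: sum.cartesian_product)
  also have "\<dots> = (\<Sum>(q,k)\<in>grid d n \<times> {..<n}. h q)"
    \<comment> \<open>The map exchanges coordinate \<open>i\<close> with the free index
      \<open>k\<close>. It is its own inverse, hence the same witness twice.\<close>
    by (rule sum.reindex_bij_witness[where i = "\<lambda>(q,k). (q(i := k), q i)" and j = "\<lambda>(q,k). (q(i := k), q i)"])
       (auto intro: grid_upd[OF _ i] grid_lt[OF _ i])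
  also have "\<dots> = n * (\<Sum>q\<in>grid d n. h q)"
    by (simp add: sum.cartesian_product[symmetric] sum_distrib_left)
  finally have "(\<Sum>q\<in>grid d n. \<Sum>k<n. h (q(i := k))) = n * (\<Sum>q\<in>grid d n. h q)" .
  moreover have "(\<Sum>q\<in>grid d n. (w q)\<^sup>2) \<le> n * (\<Sum>q\<in>grid d n. \<Sum>k<n. h (q(i := k)))"
    unfolding sum_distrib_left using pt by (intro sum_mono) (simp add: sum_distrib_left)
  ultimately show ?thesis by (simp add: h_def power2_eq_square mult.assoc)
qed

text \<open>Half the gradient of \<open>energy\<close> at \<open>u\<close> for the Euclidean inner
  product on the grid, by \<open>sum_by_parts\<close>.\<close>

definition grad :: "nat \<Rightarrow> nat \<Rightarrow> ((nat \<Rightarrow> nat) \<Rightarrow> real) \<Rightarrow> (nat \<Rightarrow> nat) \<Rightarrow> real" where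
  "grad d n u q = (\<Sum>i<d. bwd i (vio n i u) q)"

text \<open>In the expanded square \<open>cross_nonneg\<close> allows the off-diagonal terms to be
  discarded, and \<open>discrete_poincare\<close> for each \<open>vio n i u\<close> bounds the
  diagonal. No factor depending on \<open>d\<close> enters.\<close>

lemma energy_le_grad: "energy d n u \<le> (real n)\<^sup>2 * (\<Sum>q\<in>grid d n. (grad d n u q)\<^sup>2)"
proof -
  let ?c = "\<lambda>i j. \<Sum>q\<in>grid d n. bwd i (vio n i u) q * bwd j (vio n j u) q"
  have "(\<Sum>q\<in>grid d n. (grad d n u q)\<^sup>2) = (\<Sum>i<d. \<Sum>j<d. ?c i j)"
    by (simp add: grad_def power2_eq_square sum_product)
       (subst sum.swap, intro sum.cong refl, subst sum.swap, simp)
  also have "\<dots> \<ge> (\<Sum>i<d. ?c i i)"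
  proof (intro sum_mono)
    fix i assume "i \<in> {..<d}"
    then have "?c i i = (\<Sum>j\<in>{i}. ?c i j)" by simp
    also have "\<dots> \<le> (\<Sum>j<d. ?c i j)"
      by (rule sum_mono2) (use \<open>i \<in> {..<d}\<close> cross_nonneg[of i d] in auto)
    finally show "?c i i \<le> (\<Sum>j<d. ?c i j)" .
  qed
  finally have "(\<Sum>i<d. ?c i i) \<le> (\<Sum>q\<in>grid d n. (grad d n u q)\<^sup>2)" .
  then have "(real n)\<^sup>2 * (\<Sum>i<d. ?c i i) \<le> (real n)\<^sup>2 * (\<Sum>q\<in>grid d n. (grad d n u q)\<^sup>2)"
    by (rule mult_left_mono) simp
  moreover have "energy d n u \<le> (real n)\<^sup>2 * (\<Sum>i<d. ?c i i)"
    unfolding energy_def sum_distrib_left[of "(real n)\<^sup>2" _ "{..<d}"] power2_eq_square[of "bwd _ _ _", symmetric]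
    by (intro sum_mono discrete_poincare) auto
  ultimately show ?thesis by linarith
qed

text \<open>A second-order upper bound takes the place of a derivative: the slope of the square of
  \<open>min 0\<close> is Lipschitz with constant 2, so the remainder is quadratic in the
  step.\<close>

lemma energy_step:
  "energy d n (\<lambda>q. u q + t * p q) \<le> energy d n u + 2 * t * (\<Sum>q\<in>grid d n. grad d n u q * p q)
     + t\<^sup>2 * (\<Sum>i<d. \<Sum>q\<in>grid d n. (fwd n i p q)\<^sup>2)"
proof -
  have min_sq: "(min 0 (a + b))\<^sup>2 \<le> (min 0 a)\<^sup>2 + 2 * (min 0 a * b) + b\<^sup>2" for a b :: real
  proof -
    have "0 \<le> (a + b)\<^sup>2" "0 \<le> b\<^sup>2" by simp_all
    \<comment> \<open>The delicate case is that of a step crossing the kink, from \<open>a\<close>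
      nonnegative to \<open>a + b\<close> nonpositive.\<close>
    moreover have "a + b \<le> 0 \<Longrightarrow> 0 \<le> a \<Longrightarrow> \<bar>a + b\<bar> \<le> \<bar>b\<bar>" by simp
    then have "a + b \<le> 0 \<Longrightarrow> 0 \<le> a \<Longrightarrow> (a + b)\<^sup>2 \<le> b\<^sup>2" by (simp only: abs_le_square_iff)
    ultimately show ?thesis by (auto simp: min_def power2_sum)
  qed
  have fwd_add: "fwd n i (\<lambda>q. u q + t * p q) q = fwd n i u q + t * fwd n i p q" for i q
    by (simp add: fwd_def algebra_simps)
  have "energy d n (\<lambda>q. u q + t * p q) \<le> (\<Sum>i<d. \<Sum>q\<in>grid d n. (vio n i u q)\<^sup>2
      + 2 * (vio n i u q * (t * fwd n i p q)) + (t * fwd n i p q)\<^sup>2)"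
    unfolding energy_def by (intro sum_mono) (simp add: vio_def fwd_add min_sq)
  also have "\<dots> = energy d n u + 2 * t * (\<Sum>i<d. \<Sum>q\<in>grid d n. vio n i u q * fwd n i p q)
     + t\<^sup>2 * (\<Sum>i<d. \<Sum>q\<in>grid d n. (fwd n i p q)\<^sup>2)"
    by (simp add: energy_def sum.distrib sum_distrib_left power_mult_distrib mult_ac)
  also have "(\<Sum>i<d. \<Sum>q\<in>grid d n. vio n i u q * fwd n i p q)
      = (\<Sum>i<d. \<Sum>q\<in>grid d n. bwd i (vio n i u) q * p q)"
    by (intro sum.cong refl sum_by_parts vio_boundary) auto
  also have "\<dots> = (\<Sum>q\<in>grid d n. grad d n u q * p q)"
    by (subst sum.swap) (simp add: grad_def sum_distrib_right)
  finally show ?thesis .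
qed

section \<open>Reaching zero energy by minimisation\<close>

lemma fwd_continuous: "continuous_on UNIV (\<lambda>u. fwd n i u q)"
  unfolding fwd_def by (cases "Suc (q i) < n") (auto intro!: continuous_intros)

lemma energy_continuous: "continuous_on UNIV (energy d n)"
  unfolding energy_def vio_def
  by (intro continuous_intros fwd_continuous)

lemma energy_nonneg: "energy d n u \<ge> 0"
  unfolding energy_def by (intro sum_nonneg) auto

text \<open>\<open>fwd\<close> never reads \<open>u\<close> outside the grid; this provides the
  locality required by \<open>coercive_attains_min\<close>.\<close>

lemma energy_cong:
  assumes "\<And>q. q \<in> grid d n \<Longrightarrow> u q = u' q" shows "energy d n u = energy d n u'"
  unfolding energy_def vio_def fwd_def using assms grid_upd by (intro sum.cong refl) auto

text \<open>The domain consists of functions on the whole type, so the compact set is a Tychonoff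
  box around \<open>f\<close>. Coercivity disposes of functions that leave the box on
  \<open>A\<close>, and locality lets all other coordinates be reset to those of
  \<open>f\<close>.\<close>

lemma coercive_attains_min:
  fixes \<psi> :: "('a \<Rightarrow> real) \<Rightarrow> real"
  assumes cont: "continuous_on UNIV \<psi>"
    and local: "\<And>u u'. (\<And>q. q \<in> A \<Longrightarrow> u q = u' q) \<Longrightarrow> \<psi> u = \<psi> u'"
    and coercive: "\<And>u q. q \<in> A \<Longrightarrow> \<bar>u q - f q\<bar> > R \<Longrightarrow> \<psi> u \<ge> \<psi> f"
  shows "\<exists>u. \<forall>u'. \<psi> u \<le> \<psi> u'"
proof -
  \<comment> \<open>The absolute value keeps \<open>f\<close> in the box even if \<open>R\<close> is
    negative.\<close>
  let ?K = "PiE UNIV (\<lambda>q. {f q - \<bar>R\<bar>..f q + \<bar>R\<bar>})"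
  have "compactin (product_topology (\<lambda>_. euclidean) UNIV) ?K"
    by (simp add: compactin_PiE)
  then have "compact ?K"
    by (simp add: euclidean_product_topology)
  moreover have f: "f \<in> ?K" by auto
  ultimately obtain u where u: "\<forall>u'\<in>?K. \<psi> u \<le> \<psi> u'"
    using continuous_attains_inf[of ?K \<psi>] cont continuous_on_subset by blast
  have "\<psi> u \<le> \<psi> u'" for u'
  proof (cases "\<exists>q\<in>A. \<bar>u' q - f q\<bar> > R")
    case True
    then show ?thesis using coercive u f by (meson order_trans)
  next
    case False
    define u'' where "u'' q = (if q \<in> A then u' q else f q)" for q
    have "\<bar>u'' q - f q\<bar> \<le> \<bar>R\<bar>" for q
      using False by (force simp: u''_def)
    then have "u'' \<in> ?K" by (auto simp: PiE_iff abs_le_iff algebra_simps)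
    moreover have "\<psi> u' = \<psi> u''" by (rule local) (simp add: u''_def)
    ultimately show ?thesis using u by simp
  qed
  then show ?thesis by blast
qed

text \<open>Dividing by \<open>t\<close> and letting it tend to 0 from the right isolates the
  first-order terms.\<close>

lemma le_if_quadratic_bound:
  fixes a b c :: real
  assumes "e > 0" "\<And>t. 0 < t \<Longrightarrow> t < e \<Longrightarrow> t * a \<le> t * b + t\<^sup>2 * c"
  shows "a \<le> b"
proof -
  have "\<forall>\<^sub>F t in at_right 0. t < e"
    using assms(1) eventually_at_right_real by (fastforce elim: eventually_mono)
  then have "\<forall>\<^sub>F t in at_right 0. a \<le> b + t * c"
    using eventually_at_right_less[of 0]
  proof eventually_elim
    case (elim t)
    then have "t * a \<le> t * (b + t * c)" using assms(2)[of t] by (simp add: algebra_simps power2_eq_square)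
    then show ?case using elim by simp
  qed
  moreover have "((\<lambda>t. b + t * c) \<longlongrightarrow> b + 0 * c) (at_right 0)"
    by (intro tendsto_intros)
  ultimately show ?thesis
    using tendsto_lowerbound[of "\<lambda>t. b + t * c" b "at_right 0" a] by simp
qed

text \<open>The minimiser of \<open>\<surd>energy u + \<parallel>u - f\<parallel> / (2n)\<close> has zero energy: otherwise a small step
  along \<open>- grad\<close> decreases the first term at rate \<open>\<parallel>grad\<parallel> / \<surd>energy\<close>, which is at least \<open>1 / n\<close>.\<close>

lemma discrete_dist:
  assumes n: "n \<ge> 1"
  obtains u where "energy d n u = 0"
    and "(\<Sum>q\<in>grid d n. (u q - f q)\<^sup>2) \<le> 4 * (real n)\<^sup>2 * energy d n f"
proof -
  define N where "N u = L2_set u (grid d n)" for u :: "(nat \<Rightarrow> nat) \<Rightarrow> real"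
  \<comment> \<open>Any positive weight below the descent rate 1/n leads to the contradiction. Half
    the rate gives the distance \<open>2 * n * sqrt (energy d n f)\<close>, hence the constant
    4.\<close>
  define \<kappa> where "\<kappa> = 1 / (2 * real n)"
  define \<psi> where "\<psi> u = sqrt (energy d n u) + \<kappa> * N (\<lambda>q. u q - f q)" for u
  have \<kappa>: "\<kappa> > 0" using n by (simp add: \<kappa>_def)
  have N0: "N u \<ge> 0" for u by (simp add: N_def)
  have \<psi>f: "\<psi> f = sqrt (energy d n f)" by (simp add: \<psi>_def N_def L2_set_def)
  have "\<exists>u. \<forall>u'. \<psi> u \<le> \<psi> u'"
  \<comment> \<open>Beyond this radius the penalty term alone is at least
    \<open>\<psi> f\<close>.\<close>
  proof (rule coercive_attains_min[where A = "grid d n" and f = f and R = "\<psi> f / \<kappa>"])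
    show "continuous_on UNIV \<psi>"
      unfolding \<psi>_def N_def L2_set_def
      by (intro continuous_intros energy_continuous continuous_on_product_coordinates)
  next
    fix u u' :: "(nat \<Rightarrow> nat) \<Rightarrow> real" assume "\<And>q. q \<in> grid d n \<Longrightarrow> u q = u' q"
    then show "\<psi> u = \<psi> u'"
      unfolding \<psi>_def N_def using energy_cong[of d n u u'] by (simp cong: L2_set_cong)
  next
    fix u q assume q: "q \<in> grid d n" and far: "\<bar>u q - f q\<bar> > \<psi> f / \<kappa>"
    have "\<bar>u q - f q\<bar> \<le> N (\<lambda>q. u q - f q)"
      using member_le_L2_set[of "grid d n" q "\<lambda>q. \<bar>u q - f q\<bar>"] q by (simp add: N_def L2_set_def)
    with far have "\<psi> f / \<kappa> \<le> N (\<lambda>q. u q - f q)" by linarith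
    with \<kappa> have "\<psi> f \<le> \<kappa> * N (\<lambda>q. u q - f q)" by (simp add: pos_divide_le_eq mult.commute)
    then show "\<psi> f \<le> \<psi> u" by (simp add: \<psi>_def energy_nonneg add_increasing)
  qed
  then obtain u where u: "\<And>u'. \<psi> u \<le> \<psi> u'" by blast
  define p where "p = grad d n u"
  define s where "s = sqrt (energy d n u)"
  have s0: "s \<ge> 0" by (simp add: s_def energy_nonneg)
  define c where "c = (\<Sum>i<d. \<Sum>q\<in>grid d n. (fwd n i p q)\<^sup>2)"
  have "s = 0"
  proof (rule ccontr)
    assume "s \<noteq> 0"
    then have s: "s > 0" using s0 by simp
    have Np: "(N p)\<^sup>2 = (\<Sum>q\<in>grid d n. (grad d n u q)\<^sup>2)"
      by (simp add: N_def L2_set_def p_def sum_nonneg)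
    have "s\<^sup>2 \<le> (real n * N p)\<^sup>2"
      using energy_le_grad[of d n u] by (simp add: s_def energy_nonneg power_mult_distrib Np)
    then have sN: "s \<le> real n * N p" by (rule power2_le_imp_le) (simp add: N0)
    then have Np0: "N p > 0" using s N0[of p] by (cases "N p = 0") auto
    \<comment> \<open>The first-order part in \<open>t\<close> of the minimality of \<open>u\<close>
      against \<open>u - t * p\<close>, after squaring.\<close>
    have "2 * (N p)\<^sup>2 \<le> 2 * \<kappa> * s * N p"
    \<comment> \<open>Below this bound on \<open>t\<close> the number
      \<open>s - \<kappa> * t * N p\<close> is positive, so that the comparison with the square root
      of the new energy may be squared.\<close>
    proof (rule le_if_quadratic_bound[where e = "s / (\<kappa> * N p)"])
      show "0 < s / (\<kappa> * N p)" using s \<kappa> Np0 by simp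
      fix t :: real assume t: "0 < t" "t < s / (\<kappa> * N p)"
      have nn: "0 \<le> s - \<kappa> * t * N p" using t \<kappa> Np0 by (simp add: field_simps)
      have "s + \<kappa> * N (\<lambda>q. u q - f q) \<le> sqrt (energy d n (\<lambda>q. u q + (-t) * p q))
          + \<kappa> * N (\<lambda>q. (u q + (-t) * p q) - f q)"
        using u[of "\<lambda>q. u q + (-t) * p q"] by (simp add: \<psi>_def s_def)
      moreover have "N (\<lambda>q. (u q + (-t) * p q) - f q) \<le> N (\<lambda>q. u q - f q) + t * N p"
      proof -
        have "N (\<lambda>q. (u q + (-t) * p q) - f q) = N (\<lambda>q. (u q - f q) + (-t) * p q)"
          by (simp add: N_def algebra_simps)
        also have "\<dots> \<le> N (\<lambda>q. u q - f q) + N (\<lambda>q. (-t) * p q)"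
          unfolding N_def by (rule L2_set_triangle_ineq)
        also have "N (\<lambda>q. (-t) * p q) = N (\<lambda>q. t * p q)"
          by (simp add: N_def L2_set_def)
        also have "\<dots> = t * N p"
          using t by (simp add: N_def L2_set_right_distrib)
        finally show ?thesis by simp
      qed
      then have "\<kappa> * N (\<lambda>q. (u q + (-t) * p q) - f q) \<le> \<kappa> * (N (\<lambda>q. u q - f q) + t * N p)"
        using \<kappa> by (intro mult_left_mono) auto
      then have "\<kappa> * N (\<lambda>q. (u q + (-t) * p q) - f q) \<le> \<kappa> * N (\<lambda>q. u q - f q) + \<kappa> * t * N p"
        by (simp only: distrib_left mult.assoc)
      ultimately have "s - \<kappa> * t * N p \<le> sqrt (energy d n (\<lambda>q. u q + (-t) * p q))"
        by linarith
      then have "(s - \<kappa> * t * N p)\<^sup>2 \<le> (sqrt (energy d n (\<lambda>q. u q + (-t) * p q)))\<^sup>2"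
        using nn by (rule power_mono)
      also have "\<dots> = energy d n (\<lambda>q. u q + (-t) * p q)" by (simp add: energy_nonneg)
      also have "\<dots> \<le> s\<^sup>2 - 2 * t * (N p)\<^sup>2 + t\<^sup>2 * c"
        using energy_step[of d n u "-t" p] Np
        by (simp add: s_def energy_nonneg c_def p_def power2_eq_square)
      finally have "(s - \<kappa> * t * N p)\<^sup>2 \<le> s\<^sup>2 - 2 * t * (N p)\<^sup>2 + t\<^sup>2 * c" .
      moreover have "(s - \<kappa> * t * N p)\<^sup>2 = s\<^sup>2 - t * (2 * \<kappa> * s * N p) + (\<kappa> * t * N p)\<^sup>2"
        by (simp add: power2_eq_square algebra_simps)
      moreover have "0 \<le> (\<kappa> * t * N p)\<^sup>2" "t * (2 * (N p)\<^sup>2) = 2 * t * (N p)\<^sup>2" by simp_all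
      ultimately show "t * (2 * (N p)\<^sup>2) \<le> t * (2 * \<kappa> * s * N p) + t\<^sup>2 * c" by linarith
    qed
    then have "N p \<le> \<kappa> * s" using Np0 by (simp add: power2_eq_square)
    then have "2 * (real n * N p) \<le> s" using n by (simp add: \<kappa>_def field_simps)
    then show False using sN s by simp
  qed
  \<comment> \<open>Minimality is tested against \<open>f\<close> itself, where the penalty
    vanishes.\<close>
  moreover have "\<kappa> * N (\<lambda>q. u q - f q) \<le> sqrt (energy d n f)"
    using u[of f] \<open>s = 0\<close> unfolding \<psi>f by (simp add: \<psi>_def s_def)
  then have "N (\<lambda>q. u q - f q) \<le> 2 * n * sqrt (energy d n f)"
    using n by (simp add: \<kappa>_def field_simps)
  then have "(N (\<lambda>q. u q - f q))\<^sup>2 \<le> (2 * n * sqrt (energy d n f))\<^sup>2"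
    by (rule power_mono) (rule N0)
  then have "(\<Sum>q\<in>grid d n. (u q - f q)\<^sup>2) \<le> 4 * (real n)\<^sup>2 * energy d n f"
    by (simp add: N_def L2_set_def sum_nonneg power_mult_distrib energy_nonneg)
  ultimately show ?thesis using that s_def by auto
qed

section \<open>Zero energy and monotonicity\<close>

text \<open>Zero energy makes every \<open>vio\<close> vanish, so \<open>u\<close> does not decrease
  along a unit step. Induction on the l1 distance walks from \<open>q\<close> up to
  \<open>q'\<close> by such steps.\<close>

lemma energy_zero_imp_mono:
  assumes "energy d n u = 0" and q: "q \<in> grid d n" "q' \<in> grid d n" "q \<le> q'"
  shows "u q \<le> u q'"
proof -
  have step: "u q \<le> u (q(i := Suc (q i)))" if "q \<in> grid d n" "i < d" "Suc (q i) < n" for q i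
  proof -
    have "(\<Sum>q\<in>grid d n. (vio n i u q)\<^sup>2) = 0"
      using assms(1) \<open>i < d\<close> unfolding energy_def
      by (subst (asm) sum_nonneg_eq_0_iff) (auto intro: sum_nonneg)
    then have "vio n i u q = 0"
      using that by (subst (asm) sum_nonneg_eq_0_iff) auto
    then show ?thesis using that by (simp add: vio_def fwd_def min_def split: if_splits)
  qed
  show ?thesis
    using q
  proof (induction "\<Sum>i<d. q' i - q i" arbitrary: q rule: less_induct)
    case less
    show ?case
    proof (cases "\<exists>i<d. q i < q' i")
      case True
      then obtain i where i: "i < d" "q i < q' i" by blast
      have lt: "Suc (q i) < n" using i grid_lt[OF less.prems(2) i(1)] by simp
      let ?q = "q(i := Suc (q i))"
      have "(\<Sum>j<d. q' j - ?q j) < (\<Sum>j<d. q' j - q j)"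
        by (rule sum_strict_mono_ex1) (use i in auto)
      moreover have "?q \<le> q'" using less.prems(3) i by (auto simp: le_fun_def)
      ultimately have "u ?q \<le> u q'"
        using less.hyps less.prems grid_upd[OF less.prems(1) i(1) lt] by blast
      then show ?thesis using step[OF less.prems(1) i(1) lt] by simp
    next
      case False
      then have "q j = q' j" if "j < d" for j
        using less.prems(3) that by (metis le_funD le_neq_implies_less)
      \<comment> \<open>Both points are \<open>undefined\<close> outside \<open>{..<d}\<close>, so
        agreement on the first \<open>d\<close> coordinates suffices.\<close>
      then have "q = q'" using less.prems(1,2) unfolding grid_def by (intro PiE_ext) auto
      then show ?thesis by simp
    qed
  qed
qed

section \<open>Product test functions\<close>

text \<open>The family is closed under differentiation, so its members are smooth.\<close>

definition flat :: "real poly \<Rightarrow> real \<Rightarrow> real" where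
  "flat p t = (if t > 0 then poly p (1 / t) * exp (- (1 / t)) else 0)"

lemma poly_times_exp_tendsto_0: "((\<lambda>y. poly p y * exp (- y)) \<longlongrightarrow> 0) at_top" for p :: "real poly"
proof -
  have "((\<lambda>y. \<Sum>i\<le>degree p. coeff p i * (y ^ i / exp y)) \<longlongrightarrow> (\<Sum>i\<le>degree p. coeff p i * 0)) at_top"
    by (intro tendsto_intros tendsto_power_div_exp_0)
  then show ?thesis
    by (simp add: poly_altdef exp_minus field_simps sum_divide_distrib)
qed

text \<open>With y = 1/t, differentiation in t is -y^2 times differentiation in y. Applied to p(y)
  exp(-y) it gives y^2 (p - p')(y) exp(-y), which explains the new polynomial. At 0 the exponential
  decay beats every polynomial.\<close>

lemma flat_has_derivative:
  "(flat p has_real_derivative flat (monom 1 2 * (p - pderiv p)) t) (at t)"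
proof -
  consider "t > 0" | "t < 0" | "t = 0" by linarith
  then show ?thesis
  proof cases
    case 1
    have D: "((\<lambda>t. 1 / t) has_real_derivative - (1 / t\<^sup>2)) (at t)"
      using 1 by (auto intro!: derivative_eq_intros simp: power2_eq_square)
    have "((\<lambda>t. poly p (1 / t) * exp (- (1 / t))) has_real_derivative
        (poly (pderiv p) (1 / t) * - (1 / t\<^sup>2)) * exp (- (1 / t))
          + (exp (- (1 / t)) * - (- (1 / t\<^sup>2))) * poly p (1 / t)) (at t)"
      by (intro DERIV_mult DERIV_chain2[OF poly_DERIV D] DERIV_chain2[OF DERIV_exp] DERIV_minus D)
    also have "(poly (pderiv p) (1 / t) * - (1 / t\<^sup>2)) * exp (- (1 / t))
          + (exp (- (1 / t)) * - (- (1 / t\<^sup>2))) * poly p (1 / t)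
        = flat (monom 1 2 * (p - pderiv p)) t"
      using 1 by (simp add: flat_def poly_monom power_divide algebra_simps)
    finally have "((\<lambda>t. poly p (1 / t) * exp (- (1 / t))) has_real_derivative
        flat (monom 1 2 * (p - pderiv p)) t) (at t)" .
    moreover have "\<forall>\<^sub>F s in nhds t. flat p s = poly p (1 / s) * exp (- (1 / s))"
      using eventually_nhds_in_open[of "{0<..}" t] 1 by (auto simp: flat_def elim!: eventually_mono)
    ultimately show ?thesis by (subst DERIV_cong_ev) auto
  next
    case 2
    moreover have "\<forall>\<^sub>F s in nhds t. flat p s = 0"
      using eventually_nhds_in_open[of "{..<0}" t] 2 by (auto simp: flat_def elim!: eventually_mono)
    ultimately show ?thesis by (subst DERIV_cong_ev) (auto simp: flat_def)
  next
    case 3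
    have "((\<lambda>h. flat p h / h) \<longlongrightarrow> 0) (at_right 0)"
    proof -
      \<comment> \<open>Dividing by \<open>h\<close> multiplies the polynomial in
        \<open>inverse h\<close> by its variable, which is \<open>pCons 0 p\<close>.\<close>
      have "((\<lambda>h. poly (pCons 0 p) (inverse h) * exp (- inverse h)) \<longlongrightarrow> 0) (at_right (0::real))"
        by (rule filterlim_compose[OF poly_times_exp_tendsto_0 filterlim_inverse_at_top_right])
      then show ?thesis
        by (rule Lim_transform_eventually)
           (auto simp: flat_def eventually_at_filter field_simps)
    qed
    moreover have "((\<lambda>h. flat p h / h) \<longlongrightarrow> 0) (at_left 0)"
      by (rule tendsto_eventually) (auto simp: flat_def eventually_at_filter)
    ultimately have "((\<lambda>h. flat p h / h) \<longlongrightarrow> 0) (at 0)"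
      by (simp add: filterlim_at_split)
    then show ?thesis using 3 by (simp add: DERIV_def flat_def)
  qed
qed

section \<open>Smooth functions of one variable\<close>

text \<open>Finite orders of differentiability allow closure properties to be proved by induction on
  \<open>k\<close>, for all functions at once.\<close>

fun diff_times :: "nat \<Rightarrow> (real \<Rightarrow> real) \<Rightarrow> bool" where
  "diff_times 0 \<psi> = True"
| "diff_times (Suc k) \<psi> = ((\<forall>t. \<psi> differentiable (at t)) \<and> diff_times k (deriv \<psi>))"

definition smooth1 :: "(real \<Rightarrow> real) \<Rightarrow> bool" where
  "smooth1 \<psi> \<longleftrightarrow> (\<forall>k. diff_times k \<psi>)"

lemma diff_times_Suc_D: "diff_times (Suc k) \<psi> \<Longrightarrow> diff_times k \<psi>"
  by (induction k arbitrary: \<psi>) auto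

lemma diff_times_SucI:
  assumes "\<And>t. (\<psi> has_real_derivative \<psi>' t) (at t)" "diff_times k \<psi>'"
  shows "diff_times (Suc k) \<psi>"
proof -
  have "deriv \<psi> = \<psi>'" using assms(1) by (auto intro!: DERIV_imp_deriv)
  then show ?thesis using assms real_differentiable_def by auto
qed

lemma diff_times_DERIV:
  "diff_times (Suc k) \<psi> \<Longrightarrow> (\<psi> has_real_derivative deriv \<psi> t) (at t)"
  by (simp add: DERIV_deriv_iff_real_differentiable)

lemma diff_times_const: "diff_times k (\<lambda>t. c)"
proof (induction k arbitrary: c)
  case (Suc k)
  show ?case by (rule diff_times_SucI[OF _ Suc.IH[of 0]]) auto
qed simp

lemma diff_times_add: "diff_times k \<psi> \<Longrightarrow> diff_times k \<eta> \<Longrightarrow> diff_times k (\<lambda>t. \<psi> t + \<eta> t)"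
proof (induction k arbitrary: \<psi> \<eta>)
  case (Suc k)
  show ?case
  proof (rule diff_times_SucI[where \<psi>' = "\<lambda>t. deriv \<psi> t + deriv \<eta> t"])
    show "((\<lambda>t. \<psi> t + \<eta> t) has_real_derivative deriv \<psi> t + deriv \<eta> t) (at t)" for t
      by (intro DERIV_add diff_times_DERIV[OF Suc.prems(1)] diff_times_DERIV[OF Suc.prems(2)])
    show "diff_times k (\<lambda>t. deriv \<psi> t + deriv \<eta> t)"
      using Suc by auto
  qed
qed simp

lemma diff_times_mult: "diff_times k \<psi> \<Longrightarrow> diff_times k \<eta> \<Longrightarrow> diff_times k (\<lambda>t. \<psi> t * \<eta> t)"
proof (induction k arbitrary: \<psi> \<eta>)
  case (Suc k)
  show ?case
  proof (rule diff_times_SucI[where \<psi>' = "\<lambda>t. deriv \<psi> t * \<eta> t + deriv \<eta> t * \<psi> t"])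
    show "((\<lambda>t. \<psi> t * \<eta> t) has_real_derivative deriv \<psi> t * \<eta> t + deriv \<eta> t * \<psi> t) (at t)" for t
      by (intro DERIV_mult diff_times_DERIV[OF Suc.prems(1)] diff_times_DERIV[OF Suc.prems(2)])
    show "diff_times k (\<lambda>t. deriv \<psi> t * \<eta> t + deriv \<eta> t * \<psi> t)"
      \<comment> \<open>The undifferentiated factors enter the induction hypothesis with one order
        of differentiability given up.\<close>
      using Suc.prems diff_times_Suc_D by (intro diff_times_add Suc.IH) auto
  qed
qed simp

lemma diff_times_affine: "diff_times k \<psi> \<Longrightarrow> diff_times k (\<lambda>t. \<psi> (a * t + b))"
proof (induction k arbitrary: \<psi>)
  case (Suc k)
  show ?case
  proof (rule diff_times_SucI[where \<psi>' = "\<lambda>t. deriv \<psi> (a * t + b) * a"])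
    show "((\<lambda>t. \<psi> (a * t + b)) has_real_derivative deriv \<psi> (a * t + b) * a) (at t)" for t
      by (rule DERIV_chain2[OF diff_times_DERIV[OF Suc.prems]]) (auto intro!: derivative_eq_intros)
    show "diff_times k (\<lambda>t. deriv \<psi> (a * t + b) * a)"
      using Suc by (intro diff_times_mult diff_times_const) auto
  qed
qed simp

lemma smooth1_mult: "smooth1 \<psi> \<Longrightarrow> smooth1 \<eta> \<Longrightarrow> smooth1 (\<lambda>t. \<psi> t * \<eta> t)"
  and smooth1_add: "smooth1 \<psi> \<Longrightarrow> smooth1 \<eta> \<Longrightarrow> smooth1 (\<lambda>t. \<psi> t + \<eta> t)"
  and smooth1_const: "smooth1 (\<lambda>t. c)"
  and smooth1_affine: "smooth1 \<psi> \<Longrightarrow> smooth1 (\<lambda>t. \<psi> (a * t + b))"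
  by (auto simp: smooth1_def intro: diff_times_mult diff_times_add diff_times_const diff_times_affine)

lemma smooth1_deriv: "smooth1 \<psi> \<Longrightarrow> smooth1 (deriv \<psi>)"
  unfolding smooth1_def by (metis diff_times.simps(2))

lemma smooth1_DERIV: "smooth1 \<psi> \<Longrightarrow> (\<psi> has_real_derivative deriv \<psi> t) (at t)"
  unfolding smooth1_def using diff_times_DERIV by blast

lemma smooth1I:
  assumes "\<And>t. (\<psi> has_real_derivative \<psi>' t) (at t)" "smooth1 \<psi>'" shows "smooth1 \<psi>"
  unfolding smooth1_def
proof
  fix k show "diff_times k \<psi>"
    using diff_times_SucI[OF assms(1), of k] assms(2) diff_times_Suc_D smooth1_def by blast
qed

lemma smooth1_continuous: "smooth1 \<psi> \<Longrightarrow> continuous_on S \<psi>"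
  by (meson smooth1_DERIV DERIV_isCont continuous_at_imp_continuous_on)

lemma smooth1_flat: "smooth1 (flat p)"
proof -
  have "diff_times k (flat p)" for k
  proof (induction k arbitrary: p)
    case (Suc k)
    show ?case by (rule diff_times_SucI[OF flat_has_derivative Suc.IH])
  qed simp
  then show ?thesis by (simp add: smooth1_def)
qed

section \<open>Bumps and tents\<close>

text \<open>A smooth stand-in for the indicator of the open interval from \<open>a\<close> to
  \<open>b\<close>: for positive \<open>m\<close> it vanishes unless the distance to both ends
  exceeds 1/m, and it tends to the indicator as \<open>m\<close> grows.\<close>

definition bump :: "real \<Rightarrow> real \<Rightarrow> nat \<Rightarrow> real \<Rightarrow> real" where
  "bump a b m t = flat 1 (real m * (t - a) - 1) * flat 1 (real m * (b - t) - 1)"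

lemma flat_1_bounds: "0 \<le> flat 1 t" "flat 1 t \<le> 1" "t \<le> 0 \<Longrightarrow> flat 1 t = 0"
  by (auto simp: flat_def)

lemma flat_1_tendsto: "(flat 1 \<longlongrightarrow> 1) at_top"
proof -
  have "((\<lambda>t::real. exp (- (1 / t))) \<longlongrightarrow> 1) at_top" by real_asymp
  moreover have "\<forall>\<^sub>F t in at_top. exp (- (1 / t)) = flat 1 t"
    by (rule eventually_mono[OF eventually_gt_at_top[of 0]]) (simp add: flat_def)
  ultimately show ?thesis by (rule Lim_transform_eventually)
qed

lemma smooth1_bump: "smooth1 (bump a b m)"
proof -
  have "smooth1 (\<lambda>t. flat 1 (real m * t + (- real m * a - 1)) * flat 1 ((- real m) * t + (real m * b - 1)))"
    by (intro smooth1_mult smooth1_affine smooth1_flat)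
  then show ?thesis by (simp add: bump_def[abs_def] algebra_simps)
qed

lemma bump_bounds: "0 \<le> bump a b m t" "bump a b m t \<le> 1"
  by (auto simp: bump_def flat_1_bounds intro: mult_le_one)

lemma bump_eq_0:
  assumes "m > 0" "t \<notin> {a + 1 / m<..<b - 1 / m}" shows "bump a b m t = 0"
proof -
  have "real m * (t - a) - 1 \<le> 0 \<or> real m * (b - t) - 1 \<le> 0"
    using assms by (auto simp: field_simps)
  then show ?thesis by (auto simp: bump_def flat_1_bounds)
qed

lemma bump_shift: "bump (a + h) (b + h) m t = bump a b m (t - h)"
  by (simp add: bump_def algebra_simps)

lemma bump_tendsto: "(\<lambda>m. bump a b m t) \<longlonglongrightarrow> indicator {a<..<b} t"
proof (cases "a < t \<and> t < b")
  case True
  have *: "(\<lambda>m. flat 1 (real m * c - 1)) \<longlonglongrightarrow> 1" if "c > 0" for c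
  proof (rule filterlim_compose[OF flat_1_tendsto])
    show "filterlim (\<lambda>m. real m * c - 1) at_top sequentially"
      using that by real_asymp
  qed
  have "(\<lambda>m. bump a b m t) \<longlonglongrightarrow> 1 * 1"
    unfolding bump_def using True by (intro tendsto_mult *) auto
  then show ?thesis using True by simp
next
  case False
  have "real m * (t - a) \<le> 0 \<or> real m * (b - t) \<le> 0" for m
    using False by (auto simp: mult_le_0_iff)
  then have "bump a b m t = 0" for m
  proof -
    have "real m * (t - a) - 1 \<le> 0 \<or> real m * (b - t) - 1 \<le> 0"
      using \<open>\<And>m. real m * (t - a) \<le> 0 \<or> real m * (b - t) \<le> 0\<close>[of m] by linarith
    then show ?thesis by (auto simp: bump_def flat_1_bounds)
  qed
  then show ?thesis using False by simp
qed

text \<open>With \<open>X\<close> an antiderivative of a bump on a cell, \<open>X t - X (t - h)\<close> is a test profile whose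
  derivative is the difference of the bumps on two adjacent cells.\<close>

lemma tent_exists:
  assumes m: "m > 0" and h: "h > 0"
  obtains T where "smooth1 T" "deriv T = (\<lambda>t. bump a b m t - bump (a + h) (b + h) m t)"
    "\<And>t. 0 \<le> T t" "\<And>t. T t \<le> h" "\<And>t. t \<notin> {a + 1 / m..b + h - 1 / m} \<Longrightarrow> T t = 0"
proof -
  have "\<exists>X. \<forall>t. -\<infinity> < ereal t \<longrightarrow> ereal t < \<infinity> \<longrightarrow> (X has_vector_derivative bump a b m t) (at t)"
    by (intro einterval_antiderivative) (auto intro: DERIV_isCont smooth1_DERIV smooth1_bump)
  then obtain X where X: "\<And>t. (X has_real_derivative bump a b m t) (at t)"
    by (auto simp: has_real_derivative_iff_has_vector_derivative)
  define T where "T t = X t - X (t - h)" for t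
  have D: "(T has_real_derivative bump a b m t - bump (a + h) (b + h) m t) (at t)" for t
  proof -
    have "((\<lambda>t. X (t - h)) has_real_derivative bump a b m (t - h) * 1) (at t)"
      by (rule DERIV_chain2[OF X]) (auto intro!: derivative_eq_intros)
    then show ?thesis unfolding T_def bump_shift by (intro DERIV_diff X) simp
  qed
  \<comment> \<open>This yields both the bounds on \<open>T\<close> and, since \<open>z\<close> is
    within \<open>h\<close> of \<open>t\<close>, its support.\<close>
  have mvt: "\<exists>z. t - h < z \<and> z < t \<and> T t = h * bump a b m z" for t
    using MVT2[of "t - h" t X "bump a b m"] X h by (auto simp: T_def)
  show thesis
  proof
    have "smooth1 (\<lambda>t. bump a b m t + (-1) * bump (a + h) (b + h) m t)"
      by (intro smooth1_mult smooth1_add smooth1_const smooth1_bump)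
    then show "smooth1 T" using smooth1I[of T "\<lambda>t. bump a b m t - bump (a + h) (b + h) m t"] D
      by (simp only: mult_minus1 add_uminus_conv_diff)
    show "deriv T = (\<lambda>t. bump a b m t - bump (a + h) (b + h) m t)"
      by (rule ext) (rule DERIV_imp_deriv[OF D])
    have T_range: "0 \<le> T t \<and> T t \<le> h" for t
    proof -
      obtain z where "T t = h * bump a b m z" using mvt by blast
      then show ?thesis using h bump_bounds[of a b m z] by (simp add: mult_left_le)
    qed
    then show "0 \<le> T t" "T t \<le> h" for t by blast+
    show "T t = 0" if "t \<notin> {a + 1 / m..b + h - 1 / m}" for t
    proof -
      obtain z where z: "t - h < z" "z < t" "T t = h * bump a b m z" using mvt by blast
      then have "z \<notin> {a + 1 / m<..<b - 1 / m}" using that by auto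
      then show ?thesis using z m bump_eq_0 by simp
    qed
  qed
qed

section \<open>Products of one-variable profiles as test functions\<close>

text \<open>Only factor \<open>i\<close> varies with \<open>t\<close>. The derivative is kept in
  product form, so that repeated differentiation stays among the products.\<close>

lemma partial_prod:
  fixes d :: nat
  assumes "i < d" "\<And>j. j < d \<Longrightarrow> smooth1 (\<psi> j)"
  shows "((\<lambda>t. \<Prod>j<d. \<psi> j ((x(i := t)) j)) has_real_derivative
           (\<Prod>j<d. (\<psi>(i := deriv (\<psi> i))) j (x j))) (at (x i))"
proof -
  have "(\<Prod>j<d. \<psi> j ((x(i := t)) j)) = \<psi> i t * (\<Prod>j\<in>{..<d} - {i}. \<psi> j (x j))" for t
    using assms(1) prod.remove[of "{..<d}" i "\<lambda>j. \<psi> j ((x(i := t)) j)"] by simp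
  moreover have "(\<Prod>j<d. (\<psi>(i := deriv (\<psi> i))) j (x j))
      = deriv (\<psi> i) (x i) * (\<Prod>j\<in>{..<d} - {i}. \<psi> j (x j))"
    using assms(1) prod.remove[of "{..<d}" i "\<lambda>j. (\<psi>(i := deriv (\<psi> i))) j (x j)"] by simp
  ultimately show ?thesis
    using assms by (auto intro!: DERIV_cmult_right smooth1_DERIV)
qed

lemma partial_prod_eq:
  fixes d :: nat
  assumes "i < d" "\<And>j. j < d \<Longrightarrow> smooth1 (\<psi> j)"
  shows "partial i (\<lambda>x. \<Prod>j<d. \<psi> j (x j)) = (\<lambda>x. \<Prod>j<d. (\<psi>(i := deriv (\<psi> i))) j (x j))"
  unfolding partial_def by (intro ext DERIV_imp_deriv partial_prod assms)

text \<open>By induction on the multi-index every iterated partial derivative is again a product of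
  smooth profiles, so it is enough to treat products.\<close>

lemma prod_smooth_on_cube:
  assumes "\<And>j. j < d \<Longrightarrow> smooth1 (\<psi> j)"
  shows "smooth_on_cube d (\<lambda>x. \<Prod>j<d. \<psi> j (x j))"
  unfolding smooth_on_cube_def
proof (intro ballI)
  fix "is" :: "nat list" assume "is \<in> lists {..<d}"
  then have "\<exists>\<psi>'. (\<forall>j<d. smooth1 (\<psi>' j)) \<and>
      foldr partial is (\<lambda>x. \<Prod>j<d. \<psi> j (x j)) = (\<lambda>x. \<Prod>j<d. \<psi>' j (x j))"
  proof (induction "is")
    case Nil
    then show ?case using assms by auto
  next
    case (Cons i "is")
    then obtain \<psi>' where "\<forall>j<d. smooth1 (\<psi>' j)"
      "foldr partial is (\<lambda>x. \<Prod>j<d. \<psi> j (x j)) = (\<lambda>x. \<Prod>j<d. \<psi>' j (x j))" by auto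
    then show ?case using Cons.hyps
      by (intro exI[of _ "\<psi>'(i := deriv (\<psi>' i))"]) (auto simp: partial_prod_eq smooth1_deriv)
  qed
  then obtain \<psi>' where \<psi>': "\<And>j. j < d \<Longrightarrow> smooth1 (\<psi>' j)"
    and eq: "foldr partial is (\<lambda>x. \<Prod>j<d. \<psi> j (x j)) = (\<lambda>x. \<Prod>j<d. \<psi>' j (x j))" by auto
  have "continuous_on (cube d) (\<lambda>x. \<psi>' j (x j))" if "j < d" for j
    using smooth1_continuous[OF \<psi>'[OF that], of UNIV]
    by (rule continuous_on_compose2) (auto intro: continuous_on_product_coordinates continuous_on_subset)
  then have "continuous_on (cube d) (\<lambda>x. \<Prod>j<d. \<psi>' j (x j))"
    by (auto intro!: continuous_on_prod)
  moreover have "(\<lambda>t. \<Prod>j<d. \<psi>' j ((x(i := t)) j)) differentiable at (x i)" if "i < d" for i x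
    using partial_prod[of i d \<psi>' x] that \<psi>' unfolding real_differentiable_def by blast
  ultimately show "continuous_on (cube d) (foldr partial is (\<lambda>x. \<Prod>j<d. \<psi> j (x j))) \<and>
      (\<forall>i<d. \<forall>x\<in>cube d. (\<lambda>t. foldr partial is (\<lambda>x. \<Prod>j<d. \<psi> j (x j)) (x(i := t))) differentiable at (x i))"
    unfolding eq by blast
qed

lemma prod_test_function:
  assumes "\<And>j. j < d \<Longrightarrow> smooth1 (\<psi> j)" "\<And>j. j < d \<Longrightarrow> 0 < \<alpha> j" "\<And>j. j < d \<Longrightarrow> \<beta> j < 1"
    and supp: "\<And>j t. j < d \<Longrightarrow> t \<notin> {\<alpha> j..\<beta> j} \<Longrightarrow> \<psi> j t = 0"
  shows "(\<lambda>x. \<Prod>j<d. \<psi> j (x j)) \<in> test_functions d"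
proof -
  let ?S = "{x \<in> cube d. (\<Prod>j<d. \<psi> j (x j)) \<noteq> 0}"
  \<comment> \<open>Pinning the coordinates from \<open>d\<close> on to \<open>undefined\<close>
    makes the box a compact set of functions on all of \<open>nat\<close> that lies inside
    \<open>cube d\<close>.\<close>
  let ?K = "PiE UNIV (\<lambda>j. if j < d then {\<alpha> j..\<beta> j} else {undefined})"
  have "compactin (product_topology (\<lambda>_. euclidean) UNIV) ?K"
    by (simp add: compactin_PiE)
  then have K: "compact ?K" by (simp add: euclidean_product_topology)
  have "?S \<subseteq> ?K"
  proof
    fix x assume x: "x \<in> ?S"
    then have "\<psi> j (x j) \<noteq> 0" if "j < d" for j using that by auto
    then have "x j \<in> {\<alpha> j..\<beta> j}" if "j < d" for j using supp that by blast
    moreover have "x j = undefined" if "\<not> j < d" for j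
      using x that by (auto simp: cube_def PiE_iff extensional_def)
    ultimately show "x \<in> ?K" by auto
  qed
  then have cl: "closure ?S \<subseteq> ?K" using K by (simp add: closure_minimal compact_imp_closed)
  have "?K \<subseteq> cube d"
  proof
    fix x assume x: "x \<in> ?K"
    then have K: "x j \<in> (if j < d then {\<alpha> j..\<beta> j} else {undefined})" for j by (auto simp: PiE_iff)
    have "0 < x j \<and> x j < 1" if "j < d" for j
      using K[of j] assms(2,3)[OF that] that by auto
    moreover have "x j = undefined" if "\<not> j < d" for j using K[of j] that by simp
    ultimately show "x \<in> cube d" by (auto simp: cube_def PiE_iff extensional_def)
  qed
  moreover have "compact (closure ?S)"
  proof -
    have "?K \<inter> closure ?S = closure ?S" using cl by blast
    then show ?thesis using compact_Int_closed[OF K closed_closure, of ?S] by (simp only:)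
  qed
  ultimately show ?thesis
    using prod_smooth_on_cube[of d \<psi>] assms(1) cl unfolding test_functions_def by blast
qed

section \<open>Cells of the cube and density of step functions\<close>

abbreviation unit_measure :: "real measure" where
  "unit_measure \<equiv> restrict_space lborel {0<..<1}"

abbreviation borel_cube :: "nat \<Rightarrow> (nat \<Rightarrow> real) measure" where
  "borel_cube d \<equiv> \<Pi>\<^sub>M i\<in>{..<d}. unit_measure"

lemma space_unit_measure: "space unit_measure = {0<..<1}"
  by (simp add: space_restrict_space)

lemma prob_space_unit_measure: "prob_space unit_measure"
  by (rule prob_spaceI) (simp add: emeasure_restrict_space space_restrict_space)

interpretation unit_product: product_prob_space "\<lambda>_. unit_measure" "{..<d}" for d :: nat
  by (intro product_prob_spaceI prob_space_unit_measure)

lemma space_borel_cube: "space (borel_cube d) = cube d"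
  by (simp add: space_PiM cube_def space_unit_measure)

lemma space_cube_measure: "space (cube_measure d) = cube d"
  by (simp add: cube_measure_def space_borel_cube)

lemma prob_space_borel_cube: "prob_space (borel_cube d)"
  by (rule unit_product.prob_space_axioms)

lemma emeasure_cube_measure:
  "A \<in> sets (borel_cube d) \<Longrightarrow> emeasure (cube_measure d) A = emeasure (borel_cube d) A"
  by (simp add: cube_measure_def)

lemma prob_space_cube_measure: "prob_space (cube_measure d)"
  using prob_space.emeasure_space_1[OF prob_space_borel_cube, of d]
  by (intro prob_spaceI) (simp add: cube_measure_def)

lemma coordinate_measurable:
  assumes "j < d" shows "(\<lambda>x. x j) \<in> borel_measurable (borel_cube d)"
proof -
  have "(\<lambda>x. x j) \<in> measurable (borel_cube d) unit_measure"
    using assms by (intro measurable_component_singleton) auto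
  moreover have "(\<lambda>t. t) \<in> borel_measurable unit_measure"
    by (simp add: measurable_restrict_space1)
  ultimately show ?thesis by (rule measurable_compose)
qed

lemma cube_measurableI:
  "f \<in> measurable (borel_cube d) N \<Longrightarrow> f \<in> measurable (cube_measure d) N"
  unfolding cube_measure_def by (rule measurable_completion)

text \<open>The index of the half-open cell of side 1/n containing a point of the cube, restricted
  to \<open>{..<d}\<close> so as to be an element of \<open>grid\<close>.\<close>

definition cell :: "nat \<Rightarrow> nat \<Rightarrow> (nat \<Rightarrow> real) \<Rightarrow> nat \<Rightarrow> nat" where
  "cell d n x = (\<lambda>j\<in>{..<d}. nat \<lfloor>real n * x j\<rfloor>)"

lemma cell_in_grid:
  assumes "x \<in> cube d" "n \<ge> 1" shows "cell d n x \<in> grid d n"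
proof -
  have "nat \<lfloor>real n * x j\<rfloor> < n" if "j < d" for j
  proof -
    have "real n * x j < real n" using assms that by (auto simp: cube_def PiE_iff)
    then have "\<lfloor>real n * x j\<rfloor> < int n" by (simp add: floor_less_iff)
    then show ?thesis using assms(2) by simp
  qed
  then show ?thesis by (auto simp: grid_def cell_def)
qed

definition cell_set :: "nat \<Rightarrow> nat \<Rightarrow> (nat \<Rightarrow> nat) \<Rightarrow> (nat \<Rightarrow> real) set" where
  "cell_set d n q = {x \<in> cube d. cell d n x = q}"

lemma nat_floor_eq_iff:
  assumes "y > 0" shows "nat \<lfloor>y\<rfloor> = k \<longleftrightarrow> real k \<le> y \<and> y < real k + 1"
  using assms by (auto simp: nat_eq_iff floor_eq_iff le_floor_iff)

text \<open>Cells are closed below and open above. The intersection with the unit interval matters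
  only for index 0, where it drops the endpoint 0.\<close>

lemma cell_set_eq:
  assumes "q \<in> grid d n" "n \<ge> 1"
  shows "cell_set d n q = PiE {..<d} (\<lambda>j. {0<..<1} \<inter> {real (q j) / n..<real (q j) / n + 1 / n})"
proof -
  have iff: "cell d n x = q \<longleftrightarrow> (\<forall>j<d. x j \<in> {real (q j) / n..<real (q j) / n + 1 / n})" if "x \<in> cube d" for x
  proof -
    have "nat \<lfloor>real n * x j\<rfloor> = q j \<longleftrightarrow> x j \<in> {real (q j) / n..<real (q j) / n + 1 / n}" if "j < d" for j
    proof -
      have "real n * x j > 0" using \<open>x \<in> cube d\<close> that assms(2) by (auto simp: cube_def PiE_iff)
      then show ?thesis using assms(2) by (auto simp: nat_floor_eq_iff field_simps)
    qed
    moreover have "cell d n x = q \<longleftrightarrow> (\<forall>j<d. nat \<lfloor>real n * x j\<rfloor> = q j)"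
      using assms(1) by (auto simp: cell_def grid_def PiE_iff extensional_def fun_eq_iff)
    ultimately show ?thesis by simp
  qed
  show ?thesis
  proof (rule set_eqI)
    fix x
    have "x \<in> cell_set d n q \<longleftrightarrow> x \<in> cube d \<and> (\<forall>j<d. x j \<in> {real (q j) / n..<real (q j) / n + 1 / n})"
      using iff unfolding cell_set_def by blast
    then show "x \<in> cell_set d n q \<longleftrightarrow>
        x \<in> PiE {..<d} (\<lambda>j. {0<..<1} \<inter> {real (q j) / n..<real (q j) / n + 1 / n})"
      unfolding cube_def PiE_iff by blast
  qed
qed

lemma interval_in_unit_measure:
  "A \<in> sets borel \<Longrightarrow> {0<..<1} \<inter> A \<in> sets unit_measure"
  by (auto simp: sets_restrict_space)

lemma cell_set_measurable:
  assumes "q \<in> grid d n" "n \<ge> 1" shows "cell_set d n q \<in> sets (borel_cube d)"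
  unfolding cell_set_eq[OF assms]
  by (intro sets_PiM_I_finite interval_in_unit_measure) auto

lemma measure_cell_set:
  assumes "q \<in> grid d n" "n \<ge> 1" shows "measure (cube_measure d) (cell_set d n q) = (1 / n) ^ d"
proof -
  have "emeasure unit_measure ({0<..<1} \<inter> {real (q j) / n..<real (q j) / n + 1 / n}) = ennreal (1 / n)"
    if "j < d" for j
  proof -
    let ?a = "real (q j) / n"
    have "real (q j) + 1 \<le> n" using grid_lt[OF assms(1) that] by linarith
    then have b: "?a + 1 / n \<le> 1" using assms(2) by (simp add: field_simps)
    \<comment> \<open>The two sets differ at most in the point 0.\<close>
    have "emeasure lborel ({0<..<1} \<inter> {?a..<?a + 1 / n}) = emeasure lborel {?a..<?a + 1 / n}"
    proof (rule emeasure_eq_AE)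
      show "AE x in lborel. (x \<in> {0<..<1} \<inter> {?a..<?a + 1 / n}) = (x \<in> {?a..<?a + 1 / n})"
        using AE_lborel_singleton[of 0]
      proof eventually_elim
        case (elim x)
        have "0 \<le> ?a" by simp
        then have "x \<in> {?a..<?a + 1 / n} \<Longrightarrow> 0 < x \<and> x < 1" using elim b unfolding atLeastLessThan_iff by linarith
        then show ?case by auto
      qed
    qed auto
    then show ?thesis using assms(2)
      by (subst emeasure_restrict_space) (auto simp: Int_assoc)
  qed
  then have "emeasure (borel_cube d) (cell_set d n q) = (\<Prod>j<d. ennreal (1 / n))"
    unfolding cell_set_eq[OF assms]
    by (subst unit_product.emeasure_PiM) (auto intro: interval_in_unit_measure)
  also have "\<dots> = ennreal ((1 / n) ^ d)" by (simp add: ennreal_power)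
  finally show ?thesis
    using cell_set_measurable[OF assms] by (simp add: measure_def emeasure_cube_measure)
qed

lemma sum_cell_sets:
  assumes "x \<in> cube d" "n \<ge> 1"
  shows "(\<Sum>q\<in>grid d n. c q * indicator (cell_set d n q) x) = (c (cell d n x) :: real)"
proof -
  have "(\<Sum>q\<in>grid d n. c q * indicator (cell_set d n q) x)
      = (\<Sum>q\<in>grid d n. if q = cell d n x then c q else 0)"
    using assms(1) by (intro sum.cong) (auto simp: cell_set_def indicator_def)
  then show ?thesis using cell_in_grid[OF assms] by simp
qed

lemma step_measurable [measurable]:
  fixes c :: "(nat \<Rightarrow> nat) \<Rightarrow> real"
  assumes "n \<ge> 1" shows "(\<lambda>x. c (cell d n x)) \<in> borel_measurable (borel_cube d)"
proof -
  have "(\<lambda>x. \<Sum>q\<in>grid d n. c q * indicator (cell_set d n q) x) \<in> borel_measurable (borel_cube d)"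
    using assms by (intro borel_measurable_sum borel_measurable_times borel_measurable_indicator
        cell_set_measurable) auto
  then show ?thesis
    by (subst measurable_cong[where g = "\<lambda>x. \<Sum>q\<in>grid d n. c q * indicator (cell_set d n q) x"])
       (simp only: space_borel_cube sum_cell_sets[OF _ assms])
qed

section \<open>Density of step functions\<close>

text \<open>Integer division recovers the coarse cell from the fine one, so step functions of meshes
  1/n and 1/m both live on the mesh 1/(nm).\<close>

lemma step_refine:
  assumes "x \<in> cube d" "n \<ge> 1" "m \<ge> 1"
  shows "cell d n x = (\<lambda>j\<in>{..<d}. cell d (n * m) x j div m)"
proof -
  have "nat \<lfloor>real n * x j\<rfloor> = nat \<lfloor>real (n * m) * x j\<rfloor> div m" if "j < d" for j
  proof -
    have "\<lfloor>real n * x j\<rfloor> = \<lfloor>real (n * m) * x j / real m\<rfloor>" using assms(3) by simp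
    also have "\<dots> = \<lfloor>real (n * m) * x j\<rfloor> div int m"
      using floor_divide_real_eq_div[of "int m" "real (n * m) * x j"] by simp
    finally have "\<lfloor>real n * x j\<rfloor> = \<lfloor>real (n * m) * x j\<rfloor> div int m" .
    then show ?thesis by (simp add: nat_div_distrib' nat_div_distrib)
  qed
  then show ?thesis by (auto simp: cell_def)
qed

text \<open>Approximability by step functions in \<open>L\<^sup>2\<close>, with an upper integral so that integrability need
  not be tracked.\<close>

definition step_approx :: "nat \<Rightarrow> ((nat \<Rightarrow> real) \<Rightarrow> real) \<Rightarrow> bool" where
  "step_approx d f \<longleftrightarrow> f \<in> borel_measurable (borel_cube d) \<and> (\<forall>\<epsilon>>0. \<exists>n\<ge>1. \<exists>c.
     (\<integral>\<^sup>+x. ennreal ((f x - c (cell d n x))\<^sup>2) \<partial>borel_cube d) < ennreal \<epsilon>)"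

lemma step_approx_exact:
  assumes "n \<ge> 1" "\<And>x. x \<in> cube d \<Longrightarrow> f x = c (cell d n x)" shows "step_approx d f"
proof -
  have "(\<integral>\<^sup>+x. ennreal ((f x - c (cell d n x))\<^sup>2) \<partial>borel_cube d) = (\<integral>\<^sup>+x. 0 \<partial>borel_cube d)"
    using assms(2) by (intro nn_integral_cong) (simp add: space_borel_cube)
  moreover have "f \<in> borel_measurable (borel_cube d)"
    using step_measurable[OF assms(1), of c d] assms(2)
    by (subst measurable_cong) (simp_all add: space_borel_cube)
  ultimately show ?thesis
    unfolding step_approx_def using assms(1) by (auto intro!: exI[of _ n] exI[of _ c])
qed

text \<open>By dominated convergence some \<open>g k\<close> is close to \<open>f\<close>, and a
  step function close to that \<open>g k\<close> serves for \<open>f\<close>.\<close>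

lemma step_approx_limit:
  assumes app: "\<And>k. step_approx d (g k)"
    and w: "integrable (borel_cube d) (\<lambda>x. (w x)\<^sup>2)"
    and lim: "\<And>x. x \<in> cube d \<Longrightarrow> (\<lambda>k. g k x) \<longlonglongrightarrow> f x"
    and dom: "\<And>k x. x \<in> cube d \<Longrightarrow> \<bar>f x - g k x\<bar> \<le> w x"
  shows "step_approx d f"
  unfolding step_approx_def
proof (intro conjI allI impI)
  have gm: "g k \<in> borel_measurable (borel_cube d)" for k using app by (simp add: step_approx_def)
  show f: "f \<in> borel_measurable (borel_cube d)"
    by (rule borel_measurable_LIMSEQ_real[where u = g, OF _ gm]) (simp add: space_borel_cube lim)
  fix \<epsilon> :: real assume \<epsilon>: "\<epsilon> > 0"
  have "(\<lambda>k. \<integral>\<^sup>+x. ennreal ((f x - g k x)\<^sup>2) \<partial>borel_cube d) \<longlonglongrightarrow> (\<integral>\<^sup>+x. 0 \<partial>borel_cube d)"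
  proof (rule nn_integral_dominated_convergence[where w = "\<lambda>x. ennreal ((w x)\<^sup>2)"])
    show "(\<integral>\<^sup>+x. ennreal ((w x)\<^sup>2) \<partial>borel_cube d) < \<infinity>"
      using w by (simp add: integrable_iff_bounded)
    show "AE x in borel_cube d. ennreal ((f x - g k x)\<^sup>2) \<le> ennreal ((w x)\<^sup>2)" for k
    proof (rule AE_I2)
      fix x assume "x \<in> space (borel_cube d)"
      then have "\<bar>f x - g k x\<bar> \<le> \<bar>w x\<bar>" using dom[of x k] by (simp add: space_borel_cube)
      then show "ennreal ((f x - g k x)\<^sup>2) \<le> ennreal ((w x)\<^sup>2)"
        by (simp add: abs_le_square_iff ennreal_leI)
    qed
    show "AE x in borel_cube d. (\<lambda>k. ennreal ((f x - g k x)\<^sup>2)) \<longlonglongrightarrow> 0"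
    proof (rule AE_I2)
      fix x assume "x \<in> space (borel_cube d)"
      then have "(\<lambda>k. (f x - g k x)\<^sup>2) \<longlonglongrightarrow> (f x - f x)\<^sup>2"
        by (intro tendsto_intros lim) (simp add: space_borel_cube)
      then show "(\<lambda>k. ennreal ((f x - g k x)\<^sup>2)) \<longlonglongrightarrow> 0"
        using tendsto_ennrealI by fastforce
    qed
  qed (use f gm w in auto)
  \<comment> \<open>A quarter for each of the two errors, because the square of a sum is at most
    twice the sum of the squares.\<close>
  then have "\<forall>\<^sub>F k in sequentially. (\<integral>\<^sup>+x. ennreal ((f x - g k x)\<^sup>2) \<partial>borel_cube d) < ennreal (\<epsilon> / 4)"
    using \<epsilon> by (intro order_tendstoD) auto
  then obtain k where k: "(\<integral>\<^sup>+x. ennreal ((f x - g k x)\<^sup>2) \<partial>borel_cube d) < ennreal (\<epsilon> / 4)"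
    using eventually_happens'[OF sequentially_bot] by blast
  have "\<epsilon> / 4 > 0" using \<epsilon> by simp
  then obtain n c where nc: "n \<ge> 1"
    "(\<integral>\<^sup>+x. ennreal ((g k x - c (cell d n x))\<^sup>2) \<partial>borel_cube d) < ennreal (\<epsilon> / 4)"
    using app[of k] unfolding step_approx_def by meson
  have [measurable]: "(\<lambda>x. c (cell d n x)) \<in> borel_measurable (borel_cube d)"
    "f \<in> borel_measurable (borel_cube d)" "g k \<in> borel_measurable (borel_cube d)"
    using nc(1) f gm by (auto intro: step_measurable)
  have "(\<integral>\<^sup>+x. ennreal ((f x - c (cell d n x))\<^sup>2) \<partial>borel_cube d)
      \<le> (\<integral>\<^sup>+x. ennreal 2 * ennreal ((f x - g k x)\<^sup>2) + ennreal 2 * ennreal ((g k x - c (cell d n x))\<^sup>2) \<partial>borel_cube d)"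
  proof (rule nn_integral_mono)
    fix x
    have "(f x - c (cell d n x))\<^sup>2 \<le> 2 * (f x - g k x)\<^sup>2 + 2 * (g k x - c (cell d n x))\<^sup>2"
      using sum_squares_ge_zero[of 0 "(f x - g k x) - (g k x - c (cell d n x))"]
      by (simp add: power2_eq_square algebra_simps)
    then show "ennreal ((f x - c (cell d n x))\<^sup>2)
        \<le> ennreal 2 * ennreal ((f x - g k x)\<^sup>2) + ennreal 2 * ennreal ((g k x - c (cell d n x))\<^sup>2)"
      by (simp add: ennreal_mult[symmetric] ennreal_plus[symmetric] ennreal_leI del: ennreal_plus ennreal_numeral)
  qed
  also have "\<dots> = ennreal 2 * (\<integral>\<^sup>+x. ennreal ((f x - g k x)\<^sup>2) \<partial>borel_cube d)
      + ennreal 2 * (\<integral>\<^sup>+x. ennreal ((g k x - c (cell d n x))\<^sup>2) \<partial>borel_cube d)"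
    by (subst nn_integral_add) (auto simp: nn_integral_cmult)
  also have "\<dots> < ennreal 2 * ennreal (\<epsilon> / 4) + ennreal 2 * ennreal (\<epsilon> / 4)"
    using k nc(2) by (intro add_strict_mono ennreal_mult_strict_left_mono) auto
  also have "\<dots> = ennreal \<epsilon>"
    using \<epsilon> by (simp add: ennreal_mult[symmetric] ennreal_plus[symmetric] del: ennreal_plus ennreal_numeral)
  finally show "\<exists>n\<ge>1. \<exists>c. (\<integral>\<^sup>+x. ennreal ((f x - c (cell d n x))\<^sup>2) \<partial>borel_cube d) < ennreal \<epsilon>"
    using nc(1) by blast
qed

text \<open>Applying \<open>h\<close> to step functions for \<open>f\<close> and \<open>g\<close> on
  a common refinement gives an error controlled by the Lipschitz constant. Sums, maxima and
  multiples are instances.\<close>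

lemma step_approx_lipschitz2:
  assumes f: "step_approx d f" and g: "step_approx d g" and K: "K > 0"
    and lip: "\<And>a b a' b'. \<bar>h a b - h a' b'\<bar> \<le> K * (\<bar>a - a'\<bar> + \<bar>b - b'\<bar>)"
    and h: "(\<lambda>x. h (f x) (g x)) \<in> borel_measurable (borel_cube d)"
  shows "step_approx d (\<lambda>x. h (f x) (g x))"
  unfolding step_approx_def
proof (intro conjI allI impI)
  fix \<epsilon> :: real assume \<epsilon>: "\<epsilon> > 0"
  \<comment> \<open>Chosen so that \<open>2 * K\<^sup>2 * \<delta>\<close>, taken once for each
    argument, adds up to \<epsilon>.\<close>
  define \<delta> where "\<delta> = \<epsilon> / (4 * K\<^sup>2)"
  have \<delta>: "\<delta> > 0" using \<epsilon> K by (simp add: \<delta>_def)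
  obtain n c where nc: "n \<ge> 1"
    "(\<integral>\<^sup>+x. ennreal ((f x - c (cell d n x))\<^sup>2) \<partial>borel_cube d) < ennreal \<delta>"
    using f \<delta> unfolding step_approx_def by meson
  obtain m e where me: "m \<ge> 1"
    "(\<integral>\<^sup>+x. ennreal ((g x - e (cell d m x))\<^sup>2) \<partial>borel_cube d) < ennreal \<delta>"
    using g \<delta> unfolding step_approx_def by meson
  \<comment> \<open>From an index of mesh 1/(nm), division by \<open>m\<close> gives the index of
    mesh 1/n and division by \<open>n\<close> that of mesh 1/m.\<close>
  define c' where "c' q = h (c (\<lambda>j\<in>{..<d}. q j div m)) (e (\<lambda>j\<in>{..<d}. q j div n))" for q
  have c': "c' (cell d (n * m) x) = h (c (cell d n x)) (e (cell d m x))" if "x \<in> cube d" for x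
    using step_refine[OF that nc(1) me(1)] step_refine[OF that me(1) nc(1)]
    by (simp add: c'_def mult.commute[of m n])
  have [measurable]: "(\<lambda>x. c (cell d n x)) \<in> borel_measurable (borel_cube d)"
    "(\<lambda>x. e (cell d m x)) \<in> borel_measurable (borel_cube d)"
    "f \<in> borel_measurable (borel_cube d)" "g \<in> borel_measurable (borel_cube d)"
    using nc(1) me(1) f g by (auto intro: step_measurable simp: step_approx_def)
  have "(\<integral>\<^sup>+x. ennreal ((h (f x) (g x) - c' (cell d (n * m) x))\<^sup>2) \<partial>borel_cube d)
      \<le> (\<integral>\<^sup>+x. ennreal (2 * K\<^sup>2) * ennreal ((f x - c (cell d n x))\<^sup>2)
          + ennreal (2 * K\<^sup>2) * ennreal ((g x - e (cell d m x))\<^sup>2) \<partial>borel_cube d)"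
  proof (rule nn_integral_mono)
    fix x assume "x \<in> space (borel_cube d)"
    then have x: "x \<in> cube d" by (simp add: space_borel_cube)
    define a b where "a = \<bar>f x - c (cell d n x)\<bar>" "b = \<bar>g x - e (cell d m x)\<bar>"
    have "\<bar>h (f x) (g x) - c' (cell d (n * m) x)\<bar> \<le> \<bar>K * (a + b)\<bar>"
      using lip[of "f x" "g x"] unfolding c'[OF x] a_b_def by (rule order_trans) simp
    then have "(h (f x) (g x) - c' (cell d (n * m) x))\<^sup>2 \<le> (K * (a + b))\<^sup>2"
      by (simp only: abs_le_square_iff)
    also have "\<dots> = K\<^sup>2 * (a + b)\<^sup>2" by (rule power_mult_distrib)
    also have "\<dots> \<le> K\<^sup>2 * (2 * a\<^sup>2 + 2 * b\<^sup>2)"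
      using sum_squares_ge_zero[of 0 "a - b"]
      by (intro mult_left_mono) (simp_all add: power2_eq_square algebra_simps)
    also have "\<dots> = 2 * K\<^sup>2 * (f x - c (cell d n x))\<^sup>2 + 2 * K\<^sup>2 * (g x - e (cell d m x))\<^sup>2"
      by (simp add: a_b_def algebra_simps)
    finally show "ennreal ((h (f x) (g x) - c' (cell d (n * m) x))\<^sup>2) \<le>
        ennreal (2 * K\<^sup>2) * ennreal ((f x - c (cell d n x))\<^sup>2)
          + ennreal (2 * K\<^sup>2) * ennreal ((g x - e (cell d m x))\<^sup>2)"
      by (simp add: ennreal_mult[symmetric] ennreal_plus[symmetric] ennreal_leI del: ennreal_plus)
  qed
  also have "\<dots> = ennreal (2 * K\<^sup>2) * (\<integral>\<^sup>+x. ennreal ((f x - c (cell d n x))\<^sup>2) \<partial>borel_cube d)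
      + ennreal (2 * K\<^sup>2) * (\<integral>\<^sup>+x. ennreal ((g x - e (cell d m x))\<^sup>2) \<partial>borel_cube d)"
    by (subst nn_integral_add) (auto simp: nn_integral_cmult)
  also have "\<dots> < ennreal (2 * K\<^sup>2) * ennreal \<delta> + ennreal (2 * K\<^sup>2) * ennreal \<delta>"
    using K nc(2) me(2) by (intro add_strict_mono ennreal_mult_strict_left_mono) auto
  also have "\<dots> = ennreal \<epsilon>"
    using K \<epsilon> by (simp add: \<delta>_def ennreal_mult[symmetric] ennreal_plus[symmetric] del: ennreal_plus)
  finally have "(\<integral>\<^sup>+x. ennreal ((h (f x) (g x) - c' (cell d (n * m) x))\<^sup>2) \<partial>borel_cube d) < ennreal \<epsilon>" .
  moreover have "n * m \<ge> 1" using nc(1) me(1) by simp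
  ultimately show "\<exists>n\<ge>1. \<exists>c. (\<integral>\<^sup>+x. ennreal ((h (f x) (g x) - c (cell d n x))\<^sup>2) \<partial>borel_cube d) < ennreal \<epsilon>"
    by blast
qed (rule h)

lemma step_approx_const: "step_approx d (\<lambda>_. a)"
  by (rule step_approx_exact[where n = 1 and c = "\<lambda>_. a"]) auto

lemma step_approx_borel: "step_approx d f \<Longrightarrow> f \<in> borel_measurable (borel_cube d)"
  by (simp add: step_approx_def)

lemma step_approx_add:
  assumes "step_approx d f" "step_approx d g" shows "step_approx d (\<lambda>x. f x + g x)"
  by (rule step_approx_lipschitz2[OF assms, where K = 1])
     (use assms[THEN step_approx_borel] in auto)

lemma step_approx_max:
  assumes "step_approx d f" "step_approx d g" shows "step_approx d (\<lambda>x. max (f x) (g x))"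
  by (rule step_approx_lipschitz2[OF assms, where K = 1])
     (use assms[THEN step_approx_borel] in \<open>auto simp: max_def\<close>)

lemma step_approx_cmult:
  assumes "step_approx d f" shows "step_approx d (\<lambda>x. a * f x)"
\<comment> \<open>Adding 1 keeps the Lipschitz constant positive when \<open>a = 0\<close>.\<close>
proof (rule step_approx_lipschitz2[OF assms assms, where h = "\<lambda>y _. a * y" and K = "\<bar>a\<bar> + 1"])
  show "\<bar>a * y - a * y'\<bar> \<le> (\<bar>a\<bar> + 1) * (\<bar>y - y'\<bar> + \<bar>z - z'\<bar>)" for y z y' z' :: real
  proof -
    have "\<bar>a * y - a * y'\<bar> = \<bar>a\<bar> * \<bar>y - y'\<bar>" by (simp add: abs_mult[symmetric] right_diff_distrib)
    also have "\<dots> \<le> (\<bar>a\<bar> + 1) * (\<bar>y - y'\<bar> + \<bar>z - z'\<bar>)" by (intro mult_mono) auto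
    finally show ?thesis .
  qed
qed (use step_approx_borel[OF assms] in auto)

text \<open>Indicators of finite unions are maxima of indicators; the countable union is their
  pointwise limit, with errors bounded by 1.\<close>

lemma step_approx_indicator_UN:
  assumes A: "\<And>k. step_approx d (indicator (A k :: (nat \<Rightarrow> real) set))"
  shows "step_approx d (indicator (\<Union>k::nat. A k))"
proof (rule step_approx_limit[where w = "\<lambda>_. 1"])
  show "step_approx d (indicator (\<Union>k<N. A k))" for N
  proof (induction N)
    case 0
    then show ?case using step_approx_const[of d 0] by simp
  next
    case (Suc N)
    have "indicator (\<Union>k<Suc N. A k) = (\<lambda>x. max (indicator (A N) x) (indicator (\<Union>k<N. A k) x) :: real)"
      by (auto simp: fun_eq_iff indicator_def less_Suc_eq)
    then show ?case using step_approx_max[OF A[of N] Suc.IH] by simp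
  qed
  show "(\<lambda>N. indicator (\<Union>k<N. A k) x :: real) \<longlonglongrightarrow> indicator (\<Union>k. A k) x" for x
    by (rule LIMSEQ_indicator_UN)
  show "\<bar>indicator (\<Union>k. A k) x - indicator (\<Union>k<N. A k) x\<bar> \<le> (1::real)" for x N
    by (auto simp: indicator_def)
qed (use finite_measure.integrable_const[OF prob_space.finite_measure[OF prob_space_borel_cube]] in auto)

lemma step_approx_cong:
  assumes "step_approx d f" "\<And>x. x \<in> cube d \<Longrightarrow> f x = g x" shows "step_approx d g"
proof -
  have "(\<integral>\<^sup>+x. ennreal ((g x - c (cell d n x))\<^sup>2) \<partial>borel_cube d)
      = (\<integral>\<^sup>+x. ennreal ((f x - c (cell d n x))\<^sup>2) \<partial>borel_cube d)" for n c
    using assms(2) by (intro nn_integral_cong) (simp add: space_borel_cube)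
  moreover have "g \<in> borel_measurable (borel_cube d) \<longleftrightarrow> f \<in> borel_measurable (borel_cube d)"
    using assms(2) by (intro measurable_cong) (simp add: space_borel_cube)
  ultimately show ?thesis using assms(1) by (simp add: step_approx_def)
qed

text \<open>The sets with approximable indicator form a \<open>\<sigma>\<close>-algebra, and the coordinates are
  limits of step functions.\<close>

lemma step_approx_indicator:
  assumes "A \<in> sets (borel_cube d)" shows "step_approx d (indicator A)"
proof -
  define \<A> where "\<A> = {A. A \<subseteq> cube d \<and> step_approx d (indicator A)}"
  have "sigma_algebra (cube d) \<A>"
    unfolding sigma_algebra_iff2
  proof (intro conjI ballI allI impI)
    show "{} \<in> \<A>" using step_approx_cong[OF step_approx_const[of d 0], of "indicator {}"] by (simp add: \<A>_def)
    show "cube d - A \<in> \<A>" if "A \<in> \<A>" for A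
    proof -
      have "step_approx d (\<lambda>x. 1 + (-1) * indicator A x)"
        using that by (intro step_approx_add step_approx_const step_approx_cmult) (simp add: \<A>_def)
      then have "step_approx d (indicator (cube d - A))"
        by (rule step_approx_cong) (auto simp: indicator_def)
      then show ?thesis by (simp add: \<A>_def)
    qed
    show "(\<Union>k. A k) \<in> \<A>" if "range A \<subseteq> \<A>" for A :: "nat \<Rightarrow> _"
    proof -
      have "step_approx d (indicator (A k))" "A k \<subseteq> cube d" for k using that by (auto simp: \<A>_def)
      then show ?thesis using step_approx_indicator_UN[of d A] by (auto simp: \<A>_def)
    qed
  qed (auto simp: \<A>_def)
  then interpret sigma_algebra "cube d" \<A> .
  let ?S = "sigma (cube d) \<A>"
  have S: "sets ?S = \<A>" "space ?S = cube d"
    using space_closed by (auto simp: sigma_sets_eq)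
  \<comment> \<open>Measurability of the identity into \<open>borel_cube d\<close> says that the
    measurable sets of the product belong to \<open>\<A>\<close>; it can be checked on
    coordinates.\<close>
  have "(\<lambda>x. x) \<in> measurable ?S (borel_cube d)"
  proof (rule measurable_PiM_single')
    fix j assume "j \<in> {..<d}"
    then have j: "j < d" by simp
    \<comment> \<open>A level set of one cell index is a union of cells, so its indicator is a step
      function.\<close>
    have cellm: "(\<lambda>x. cell d n x j) \<in> measurable ?S (count_space UNIV)" if n: "n \<ge> 1" for n
    proof (subst measurable_count_space_eq_countable)
      have "(\<lambda>x. cell d n x j) -` {k} \<inter> cube d \<in> \<A>" for k
      proof -
        have "step_approx d (indicator ((\<lambda>x. cell d n x j) -` {k} \<inter> cube d))"
          by (rule step_approx_exact[OF n, where c = "\<lambda>q. of_bool (q j = k)"]) (auto simp: indicator_def)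
        then show ?thesis by (simp add: \<A>_def)
      qed
      then show "(\<lambda>x. cell d n x j) \<in> space ?S \<rightarrow> UNIV \<and>
          (\<forall>a\<in>UNIV. (\<lambda>x. cell d n x j) -` {a} \<inter> space ?S \<in> sets ?S)"
        unfolding S by blast
    qed simp
    have "(\<lambda>x. x j) \<in> borel_measurable ?S"
    proof (rule borel_measurable_LIMSEQ_real)
      show "(\<lambda>x. real (cell d (Suc n) x j) / real (Suc n)) \<in> borel_measurable ?S" for n
        by (rule measurable_compose[OF cellm]) auto
      fix x assume "x \<in> space ?S"
      then have "x \<in> cube d" by (simp only: S)
      then have x: "0 < x j" using j by (auto simp: cube_def PiE_iff)
      show "(\<lambda>n. real (cell d (Suc n) x j) / real (Suc n)) \<longlonglongrightarrow> x j"
      proof (rule real_tendsto_sandwich)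
        have bounds: "x j - inverse (real (Suc n)) \<le> real (cell d (Suc n) x j) / real (Suc n) \<and>
            real (cell d (Suc n) x j) / real (Suc n) \<le> x j" for n
        proof -
          define y where "y = real (Suc n)"
          have y: "y > 0" by (simp add: y_def)
          have "0 \<le> \<lfloor>y * x j\<rfloor>" using x y by simp
          then have c: "real (cell d (Suc n) x j) = of_int \<lfloor>y * x j\<rfloor>"
            using j by (simp add: cell_def y_def)
          have "(x j - inverse y) * y = y * x j - 1" using y by (simp add: algebra_simps)
          also have "\<dots> \<le> of_int \<lfloor>y * x j\<rfloor>" by linarith
          finally have "x j - inverse y \<le> of_int \<lfloor>y * x j\<rfloor> / y" using y by (simp only: pos_le_divide_eq)
          moreover have "of_int \<lfloor>y * x j\<rfloor> \<le> x j * y" by (simp add: mult.commute)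
          then have "of_int \<lfloor>y * x j\<rfloor> / y \<le> x j" using y by (simp only: pos_divide_le_eq)
          ultimately show ?thesis unfolding c y_def by blast
        qed
        show "\<forall>\<^sub>F n in sequentially. x j - inverse (real (Suc n)) \<le> real (cell d (Suc n) x j) / real (Suc n)"
          "\<forall>\<^sub>F n in sequentially. real (cell d (Suc n) x j) / real (Suc n) \<le> x j"
          by (intro always_eventually allI bounds[THEN conjunct1] bounds[THEN conjunct2])+
        have "(\<lambda>n. x j - inverse (real (Suc n))) \<longlonglongrightarrow> x j - 0"
          by (intro tendsto_intros LIMSEQ_inverse_real_of_nat)
        then show "(\<lambda>n. x j - inverse (real (Suc n))) \<longlonglongrightarrow> x j" by simp
      qed simp
    qed
    then have "(\<lambda>x. x j) \<in> measurable ?S lborel" by (simp only: measurable_lborel1)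
    moreover have "(\<lambda>x. x j) \<in> space ?S \<rightarrow> {0<..<1}"
      unfolding S using j by (auto simp: cube_def PiE_iff)
    ultimately show "(\<lambda>x. x j) \<in> measurable ?S unit_measure"
      by (rule measurable_restrict_space2[rotated])
  next
    show "(\<lambda>x. x) \<in> space ?S \<rightarrow> (\<Pi>\<^sub>E i\<in>{..<d}. space unit_measure)"
      unfolding S space_unit_measure by (simp add: cube_def)
  qed
  from measurable_sets[OF this assms] have "A \<inter> cube d \<in> \<A>" by (simp only: S vimage_ident)
  then have "step_approx d (indicator (A \<inter> cube d))" by (simp add: \<A>_def)
  then show ?thesis by (rule step_approx_cong) (auto simp: indicator_def)
qed

lemma step_approx_simple:
  fixes s :: "(nat \<Rightarrow> real) \<Rightarrow> real"
  assumes s: "simple_function (borel_cube d) s" shows "step_approx d s"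
proof -
  have "step_approx d (\<lambda>x. \<Sum>y\<in>Y. y * indicator (s -` {y} \<inter> cube d) x)" if "finite Y" for Y
    using that
  proof (induction Y)
    case (insert y Y)
    have "s -` {y} \<inter> cube d \<in> sets (borel_cube d)"
      using simple_functionD(2)[OF s, of "{y}"] by (simp add: space_borel_cube)
    then have "step_approx d (\<lambda>x. y * indicator (s -` {y} \<inter> cube d) x
        + (\<Sum>y\<in>Y. y * indicator (s -` {y} \<inter> cube d) x))"
      by (intro step_approx_add step_approx_cmult step_approx_indicator insert.IH)
    then show ?case using insert.hyps by (simp only: sum.insert not_False_eq_True)
  qed (simp add: step_approx_const)
  moreover have fin: "finite (s ` cube d)" using simple_functionD(1)[OF s] by (simp add: space_borel_cube)
  ultimately have "step_approx d (\<lambda>x. \<Sum>y\<in>s ` cube d. y * indicator (s -` {y} \<inter> cube d) x)" by blast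
  then show ?thesis
  proof (rule step_approx_cong)
    fix x assume x: "x \<in> cube d"
    then have "(\<Sum>y\<in>s ` cube d. y * indicator (s -` {y} \<inter> cube d) x) = (\<Sum>y\<in>s ` cube d. if y = s x then y else 0)"
      by (intro sum.cong) (auto simp: indicator_def)
    also have "\<dots> = s x" using fin x by simp
    finally show "(\<Sum>y\<in>s ` cube d. y * indicator (s -` {y} \<inter> cube d) x) = s x" .
  qed
qed

text \<open>Simple functions bounded by twice \<bar>f\<bar> converge to \<open>f\<close>, so three
  times \<bar>f\<bar> dominates the error in \<open>step_approx_limit\<close>.\<close>

lemma step_approx_square_integrable:
  assumes f: "f \<in> borel_measurable (borel_cube d)" and f2: "integrable (borel_cube d) (\<lambda>x. (f x)\<^sup>2)"
  shows "step_approx d f"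
proof -
  obtain s where s: "\<And>k. simple_function (borel_cube d) (s k)"
    "\<And>x. x \<in> space (borel_cube d) \<Longrightarrow> (\<lambda>k. s k x) \<longlonglongrightarrow> f x"
    "\<And>k x. x \<in> space (borel_cube d) \<Longrightarrow> dist (s k x) 0 \<le> 2 * dist (f x) 0"
    using borel_measurable_implies_sequence_metric[OF f, of 0] by blast
  show ?thesis
  proof (rule step_approx_limit[where g = s and w = "\<lambda>x. 3 * \<bar>f x\<bar>"])
    show "integrable (borel_cube d) (\<lambda>x. (3 * \<bar>f x\<bar>)\<^sup>2)"
      using f2 by (simp add: power_mult_distrib)
    fix k x assume "x \<in> cube d"
    then have "\<bar>s k x\<bar> \<le> 2 * \<bar>f x\<bar>" using s(3)[of x k] by (simp add: space_borel_cube dist_norm)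
    then show "\<bar>f x - s k x\<bar> \<le> 3 * \<bar>f x\<bar>" by linarith
  qed (use s(1,2) step_approx_simple in \<open>auto simp: space_borel_cube\<close>)
qed

text \<open>\<open>step_approx\<close> refers to the uncompleted product measure, so
  \<open>f\<close> is first replaced by a Borel representative, which changes none of the
  integrals.\<close>

lemma L2_step_dense:
  assumes f: "f \<in> L2 d" and \<epsilon>: "\<epsilon> > 0"
  obtains n c where "n \<ge> 1" "integrable (cube_measure d) (\<lambda>x. (f x - c (cell d n x))\<^sup>2)"
    "(\<integral>x. (f x - c (cell d n x))\<^sup>2 \<partial>cube_measure d) < \<epsilon>"
proof -
  have fm: "f \<in> borel_measurable (cube_measure d)" and f2: "integrable (cube_measure d) (\<lambda>x. (f x)\<^sup>2)"
    using f by (auto simp: L2_def)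
  obtain f' where f': "f' \<in> borel_measurable (borel_cube d)" "AE x in borel_cube d. f x = f' x"
    using completion_ex_borel_measurable_real[OF fm[unfolded cube_measure_def]] by blast
  have ae: "AE x in cube_measure d. f x = f' x"
    using f'(2) unfolding cube_measure_def by (rule AE_completion)
  have f'm: "f' \<in> borel_measurable (cube_measure d)" using f'(1) by (rule cube_measurableI)
  have "integrable (cube_measure d) (\<lambda>x. (f' x)\<^sup>2)"
    by (rule integrable_cong_AE_imp[OF f2]) (use f'm ae in auto)
  then have "integrable (borel_cube d) (\<lambda>x. (f' x)\<^sup>2)"
    using f'(1) unfolding cube_measure_def by (subst (asm) integrable_completion) auto
  with f'(1) have "step_approx d f'" by (rule step_approx_square_integrable)
  then obtain n c where nc: "n \<ge> 1"
    "(\<integral>\<^sup>+x. ennreal ((f' x - c (cell d n x))\<^sup>2) \<partial>borel_cube d) < ennreal \<epsilon>"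
    using \<epsilon> unfolding step_approx_def by meson
  have cm: "(\<lambda>x. c (cell d n x)) \<in> borel_measurable (cube_measure d)"
    by (rule cube_measurableI[OF step_measurable[OF nc(1)]])
  have [measurable]: "(\<lambda>x. c (cell d n x)) \<in> borel_measurable (borel_cube d)" "f' \<in> borel_measurable (borel_cube d)"
    using step_measurable[OF nc(1)] f'(1) by auto
  have "(\<integral>\<^sup>+x. ennreal ((f x - c (cell d n x))\<^sup>2) \<partial>cube_measure d)
      = (\<integral>\<^sup>+x. ennreal ((f' x - c (cell d n x))\<^sup>2) \<partial>cube_measure d)"
    by (rule nn_integral_cong_AE, use ae in eventually_elim) simp
  also have "\<dots> = (\<integral>\<^sup>+x. ennreal ((f' x - c (cell d n x))\<^sup>2) \<partial>borel_cube d)"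
    unfolding cube_measure_def by (rule nn_integral_completion)
  finally have lt: "(\<integral>\<^sup>+x. ennreal ((f x - c (cell d n x))\<^sup>2) \<partial>cube_measure d) < ennreal \<epsilon>"
    using nc(2) by simp
  have m: "(\<lambda>x. (f x - c (cell d n x))\<^sup>2) \<in> borel_measurable (cube_measure d)"
    using fm cm by measurable
  have int: "integrable (cube_measure d) (\<lambda>x. (f x - c (cell d n x))\<^sup>2)"
  proof (rule integrableI_nonneg[OF m])
    show "(\<integral>\<^sup>+x. ennreal ((f x - c (cell d n x))\<^sup>2) \<partial>cube_measure d) < \<infinity>"
      using lt by (rule less_trans) simp
  qed simp
  have "ennreal (\<integral>x. (f x - c (cell d n x))\<^sup>2 \<partial>cube_measure d) < ennreal \<epsilon>"
    using lt by (subst nn_integral_eq_integral[OF int, symmetric]) auto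
  then have "(\<integral>x. (f x - c (cell d n x))\<^sup>2 \<partial>cube_measure d) < \<epsilon>"
    by (simp add: ennreal_less_iff)
  then show thesis using that nc(1) int by blast
qed

section \<open>Cell averages\<close>

lemma L2_measurable: "f \<in> L2 d \<Longrightarrow> f \<in> borel_measurable (cube_measure d)"
  and L2_square_integrable: "f \<in> L2 d \<Longrightarrow> integrable (cube_measure d) (\<lambda>x. (f x)\<^sup>2)"
  by (simp_all add: L2_def)

lemma integrable_cube_const: "integrable (cube_measure d) (\<lambda>x. c :: real)"
  by (rule finite_measure.integrable_const[OF prob_space.finite_measure[OF prob_space_cube_measure]])

lemma integrable_cube_bounded:
  fixes f :: "(nat \<Rightarrow> real) \<Rightarrow> real"
  assumes f: "integrable (cube_measure d) f" and k: "k \<in> borel_measurable (cube_measure d)"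
    and bd: "\<And>x. x \<in> cube d \<Longrightarrow> \<bar>k x\<bar> \<le> K"
  shows "integrable (cube_measure d) (\<lambda>x. f x * k x)"
proof (rule Bochner_Integration.integrable_bound)
  show "integrable (cube_measure d) (\<lambda>x. K * f x)" using f by simp
  show "(\<lambda>x. f x * k x) \<in> borel_measurable (cube_measure d)"
    using f k by (intro borel_measurable_times) (auto intro: borel_measurable_integrable)
  show "AE x in cube_measure d. norm (f x * k x) \<le> norm (K * f x)"
  proof (rule AE_I2)
    fix x assume "x \<in> space (cube_measure d)"
    then have "\<bar>k x\<bar> \<le> \<bar>K\<bar>" using bd[of x] by (simp add: space_cube_measure)
    then have "\<bar>f x\<bar> * \<bar>k x\<bar> \<le> \<bar>f x\<bar> * \<bar>K\<bar>" by (rule mult_left_mono) simp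
    then show "norm (f x * k x) \<le> norm (K * f x)" by (simp add: abs_mult mult.commute)
  qed
qed

text \<open>The measure is finite, so 1 + f^2 is integrable, and it dominates \<bar>f\<bar>.\<close>

lemma L2_integrable:
  assumes "f \<in> L2 d" shows "integrable (cube_measure d) f"
proof (rule Bochner_Integration.integrable_bound)
  show "integrable (cube_measure d) (\<lambda>x. 1 + (f x)\<^sup>2)"
    using L2_square_integrable[OF assms] integrable_cube_const by (rule Bochner_Integration.integrable_add[rotated])
  show "AE x in cube_measure d. norm (f x) \<le> norm (1 + (f x)\<^sup>2)"
  proof (rule AE_I2)
    fix x
    have "0 \<le> (\<bar>f x\<bar> - 1)\<^sup>2" by simp
    then have "2 * \<bar>f x\<bar> \<le> 1 + (f x)\<^sup>2" by (simp add: power2_diff)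
    then show "norm (f x) \<le> norm (1 + (f x)\<^sup>2)" by simp
  qed
qed (rule L2_measurable[OF assms])

lemma L2_min_0:
  assumes "f \<in> L2 d" shows "(\<lambda>x. min 0 (f x)) \<in> L2 d"
proof -
  have m: "(\<lambda>x. min 0 (f x)) \<in> borel_measurable (cube_measure d)"
    using L2_measurable[OF assms] by measurable
  moreover have "integrable (cube_measure d) (\<lambda>x. (min 0 (f x))\<^sup>2)"
  proof (rule Bochner_Integration.integrable_bound[OF L2_square_integrable[OF assms]])
    show "(\<lambda>x. (min 0 (f x))\<^sup>2) \<in> borel_measurable (cube_measure d)" using m by measurable
    show "AE x in cube_measure d. norm ((min 0 (f x))\<^sup>2) \<le> norm ((f x)\<^sup>2)"
      by (rule AE_I2) (simp add: min_def)
  qed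
  ultimately show ?thesis by (simp add: L2_def)
qed

lemma cell_set_measurable_cube:
  "q \<in> grid d n \<Longrightarrow> n \<ge> 1 \<Longrightarrow> cell_set d n q \<in> sets (cube_measure d)"
  using cell_set_measurable unfolding cube_measure_def by (rule sets_completionI_sets)

lemma integrable_on_cell:
  fixes f :: "(nat \<Rightarrow> real) \<Rightarrow> real"
  assumes "integrable (cube_measure d) f" "q \<in> grid d n" "n \<ge> 1"
  shows "integrable (cube_measure d) (\<lambda>x. f x * indicator (cell_set d n q) x)"
  using cell_set_measurable_cube[OF assms(2,3)]
  by (intro integrable_cube_bounded[OF assms(1), where K = 1]) (auto simp: indicator_def)

lemma integral_sum_cells:
  fixes f :: "(nat \<Rightarrow> real) \<Rightarrow> real"
  assumes "integrable (cube_measure d) f" "n \<ge> 1"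
  shows "(\<integral>x. f x \<partial>cube_measure d) = (\<Sum>q\<in>grid d n. \<integral>x. f x * indicator (cell_set d n q) x \<partial>cube_measure d)"
proof -
  have "(\<Sum>q\<in>grid d n. \<integral>x. f x * indicator (cell_set d n q) x \<partial>cube_measure d)
      = (\<integral>x. (\<Sum>q\<in>grid d n. f x * indicator (cell_set d n q) x) \<partial>cube_measure d)"
    by (rule Bochner_Integration.integral_sum[symmetric]) (rule integrable_on_cell[OF assms(1) _ assms(2)])
  also have "\<dots> = (\<integral>x. f x \<partial>cube_measure d)"
  proof (rule Bochner_Integration.integral_cong)
    fix x assume "x \<in> space (cube_measure d)"
    then have "(\<Sum>q\<in>grid d n. 1 * indicator (cell_set d n q) x) = (1::real)"
      using sum_cell_sets[of x d n "\<lambda>_. 1"] assms(2) by (simp add: space_cube_measure)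
    then have "f x * (\<Sum>q\<in>grid d n. indicator (cell_set d n q) x) = f x" by simp
    then show "(\<Sum>q\<in>grid d n. f x * indicator (cell_set d n q) x) = f x"
      by (simp only: sum_distrib_left)
  qed simp
  finally show ?thesis by simp
qed

lemma step_integrable:
  fixes c :: "(nat \<Rightarrow> nat) \<Rightarrow> real"
  assumes "n \<ge> 1" shows "integrable (cube_measure d) (\<lambda>x. c (cell d n x))"
proof -
  have "integrable (cube_measure d) (\<lambda>x. 1 * c (cell d n x))"
  proof (rule integrable_cube_bounded[OF integrable_cube_const, where K = "\<Sum>q\<in>grid d n. \<bar>c q\<bar>"])
    show "(\<lambda>x. c (cell d n x)) \<in> borel_measurable (cube_measure d)"
      by (rule cube_measurableI[OF step_measurable[OF assms]])
    show "\<bar>c (cell d n x)\<bar> \<le> (\<Sum>q\<in>grid d n. \<bar>c q\<bar>)" if "x \<in> cube d" for x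
      by (rule member_le_sum[where f = "\<lambda>q. \<bar>c q\<bar>"]) (auto simp: cell_in_grid[OF that assms])
  qed
  then show ?thesis by simp
qed

lemma integral_indicator_cell:
  assumes "q \<in> grid d n" "n \<ge> 1"
  shows "(\<integral>x. indicator (cell_set d n q) x \<partial>cube_measure d) = (1 / real n) ^ d"
proof -
  have "cell_set d n q \<inter> space (cube_measure d) = cell_set d n q"
    by (auto simp: cell_set_def space_cube_measure)
  then show ?thesis by (simp add: measure_cell_set[OF assms])
qed

lemma step_integral:
  fixes c :: "(nat \<Rightarrow> nat) \<Rightarrow> real"
  assumes "n \<ge> 1"
  shows "(\<integral>x. c (cell d n x) \<partial>cube_measure d) = (1 / n) ^ d * (\<Sum>q\<in>grid d n. c q)"
proof -
  have "(\<integral>x. c (cell d n x) * indicator (cell_set d n q) x \<partial>cube_measure d) = (1 / n) ^ d * c q"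
    if q: "q \<in> grid d n" for q
  proof -
    have "(\<integral>x. c (cell d n x) * indicator (cell_set d n q) x \<partial>cube_measure d)
        = (\<integral>x. c q * indicator (cell_set d n q) x \<partial>cube_measure d)"
      by (rule Bochner_Integration.integral_cong) (auto simp: cell_set_def indicator_def)
    also have "\<dots> = c q * (1 / n) ^ d"
      by (simp only: integral_mult_right_zero integral_indicator_cell[OF q assms])
    finally show ?thesis by simp
  qed
  then show ?thesis
    by (simp add: integral_sum_cells[OF step_integrable[OF assms] assms] sum_distrib_left)
qed

text \<open>The factor \<open>real n ^ d\<close> is the reciprocal of the volume of a cell.\<close>

definition cell_average :: "nat \<Rightarrow> nat \<Rightarrow> ((nat \<Rightarrow> real) \<Rightarrow> real) \<Rightarrow> (nat \<Rightarrow> nat) \<Rightarrow> real" where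
  "cell_average d n f q = real n ^ d * (\<integral>x. f x * indicator (cell_set d n q) x \<partial>cube_measure d)"

text \<open>The variance of \<open>f\<close> on the cell is nonnegative; expanding the square around
  the mean \<open>m\<close> gives the claim.\<close>

lemma cell_average_jensen:
  assumes f: "integrable (cube_measure d) f" and f2: "integrable (cube_measure d) (\<lambda>x. (f x)\<^sup>2)"
    and q: "q \<in> grid d n" and n: "n \<ge> 1"
  shows "(cell_average d n f q)\<^sup>2 \<le> cell_average d n (\<lambda>x. (f x)\<^sup>2) q"
proof -
  define m where "m = cell_average d n f q"
  let ?I = "indicator (cell_set d n q) :: _ \<Rightarrow> real"
  have N: "real n ^ d > 0" "real n ^ d * (1 / real n) ^ d = 1"
    using n by (simp_all add: power_mult_distrib[symmetric])
  have I1: "integrable (cube_measure d) (\<lambda>x. f x * ?I x)"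
    and I2: "integrable (cube_measure d) (\<lambda>x. (f x)\<^sup>2 * ?I x)"
    and I0: "integrable (cube_measure d) (\<lambda>x. 1 * ?I x)"
    by (intro integrable_on_cell f f2 q n integrable_cube_const)+
  have one: "(\<integral>x. 1 * ?I x \<partial>cube_measure d) = (1 / n) ^ d"
    by (simp only: mult_1_left integral_indicator_cell[OF q n])
  have "0 \<le> (\<integral>x. (f x - m)\<^sup>2 * ?I x \<partial>cube_measure d)"
    by (rule Bochner_Integration.integral_nonneg) simp
  also have "\<dots> = (\<integral>x. ((f x)\<^sup>2 * ?I x - 2 * m * (f x * ?I x)) + m\<^sup>2 * (1 * ?I x) \<partial>cube_measure d)"
    by (rule Bochner_Integration.integral_cong) (auto simp: power2_eq_square algebra_simps)
  also have "\<dots> = (\<integral>x. (f x)\<^sup>2 * ?I x \<partial>cube_measure d) - 2 * m * (\<integral>x. f x * ?I x \<partial>cube_measure d)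
      + m\<^sup>2 * (\<integral>x. 1 * ?I x \<partial>cube_measure d)"
    using I0 I1 I2 by (simp only: Bochner_Integration.integral_add Bochner_Integration.integral_diff
        integral_mult_right_zero integrable_mult_right Bochner_Integration.integrable_diff)
  finally have "0 \<le> real n ^ d * ((\<integral>x. (f x)\<^sup>2 * ?I x \<partial>cube_measure d)
      - 2 * m * (\<integral>x. f x * ?I x \<partial>cube_measure d) + m\<^sup>2 * (1 / n) ^ d)"
    unfolding one using N(1) by simp
  also have "\<dots> = real n ^ d * (\<integral>x. (f x)\<^sup>2 * ?I x \<partial>cube_measure d)
      - 2 * m * (real n ^ d * (\<integral>x. f x * ?I x \<partial>cube_measure d)) + m\<^sup>2 * (real n ^ d * (1 / n) ^ d)"
    by (simp only: algebra_simps)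
  also have "\<dots> = cell_average d n (\<lambda>x. (f x)\<^sup>2) q - m\<^sup>2"
    unfolding N(2) cell_average_def[symmetric] m_def[symmetric] by (simp add: power2_eq_square)
  finally show ?thesis by (simp add: m_def)
qed

lemma sum_cell_average:
  assumes "integrable (cube_measure d) f" "n \<ge> 1"
  shows "(\<Sum>q\<in>grid d n. cell_average d n f q) = real n ^ d * (\<integral>x. f x \<partial>cube_measure d)"
  by (simp add: cell_average_def integral_sum_cells[OF assms] sum_distrib_left)

text \<open>Jensen's inequality summed over the cells: up to the cell volume, averaging is a
  contraction in the L2 norm.\<close>

lemma sum_cell_average_square:
  assumes "f \<in> L2 d" "n \<ge> 1"
  shows "(\<Sum>q\<in>grid d n. (cell_average d n f q)\<^sup>2) \<le> real n ^ d * (\<integral>x. (f x)\<^sup>2 \<partial>cube_measure d)"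
proof -
  have "(\<Sum>q\<in>grid d n. (cell_average d n f q)\<^sup>2) \<le> (\<Sum>q\<in>grid d n. cell_average d n (\<lambda>x. (f x)\<^sup>2) q)"
    by (intro sum_mono cell_average_jensen L2_integrable[OF assms(1)] L2_square_integrable[OF assms(1)] assms(2))
  then show ?thesis by (simp add: sum_cell_average[OF L2_square_integrable[OF assms(1)] assms(2)])
qed

lemma L2_step: "n \<ge> 1 \<Longrightarrow> (\<lambda>x. c (cell d n x)) \<in> L2 d"
  using cube_measurableI[OF step_measurable] step_integrable[of n d "\<lambda>q. (c q)\<^sup>2"]
  by (simp add: L2_def)

lemma L2_diff:
  assumes "f \<in> L2 d" "g \<in> L2 d" shows "(\<lambda>x. f x - g x) \<in> L2 d"
proof -
  have m: "(\<lambda>x. f x - g x) \<in> borel_measurable (cube_measure d)"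
    using assms[THEN L2_measurable] by measurable
  have "integrable (cube_measure d) (\<lambda>x. (f x - g x)\<^sup>2)"
  proof (rule Bochner_Integration.integrable_bound)
    show "integrable (cube_measure d) (\<lambda>x. 2 * (f x)\<^sup>2 + 2 * (g x)\<^sup>2)"
      using assms[THEN L2_square_integrable] by simp
    show "(\<lambda>x. (f x - g x)\<^sup>2) \<in> borel_measurable (cube_measure d)" using m by measurable
    show "AE x in cube_measure d. norm ((f x - g x)\<^sup>2) \<le> norm (2 * (f x)\<^sup>2 + 2 * (g x)\<^sup>2)"
    proof (rule AE_I2)
      fix x
      have "0 \<le> (f x + g x)\<^sup>2" by simp
      then have "(f x - g x)\<^sup>2 \<le> 2 * (f x)\<^sup>2 + 2 * (g x)\<^sup>2"
        by (simp add: power2_eq_square algebra_simps)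
      then show "norm ((f x - g x)\<^sup>2) \<le> norm (2 * (f x)\<^sup>2 + 2 * (g x)\<^sup>2)"
        by simp
    qed
  qed
  with m show ?thesis by (simp add: L2_def)
qed

lemma integral_square_diff_triangle:
  assumes "f \<in> L2 d" "g \<in> L2 d" "h \<in> L2 d"
  shows "(\<integral>x. (f x - h x)\<^sup>2 \<partial>cube_measure d)
    \<le> 2 * (\<integral>x. (f x - g x)\<^sup>2 \<partial>cube_measure d) + 2 * (\<integral>x. (g x - h x)\<^sup>2 \<partial>cube_measure d)"
proof -
  have I: "integrable (cube_measure d) (\<lambda>x. (f x - h x)\<^sup>2)" "integrable (cube_measure d) (\<lambda>x. (f x - g x)\<^sup>2)"
    "integrable (cube_measure d) (\<lambda>x. (g x - h x)\<^sup>2)"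
    by (intro L2_square_integrable L2_diff assms)+
  have "(\<integral>x. (f x - h x)\<^sup>2 \<partial>cube_measure d)
      \<le> (\<integral>x. 2 * (f x - g x)\<^sup>2 + 2 * (g x - h x)\<^sup>2 \<partial>cube_measure d)"
  proof (rule integral_mono)
    fix x
    have "0 \<le> ((f x - g x) - (g x - h x))\<^sup>2" by simp
    then show "(f x - h x)\<^sup>2 \<le> 2 * (f x - g x)\<^sup>2 + 2 * (g x - h x)\<^sup>2"
      by (simp add: power2_eq_square algebra_simps)
  qed (use I in auto)
  then show ?thesis using I by simp
qed

text \<open>Averaging fixes step functions and contracts the L2 norm, so \<open>c\<close> is no
  farther from the averages of \<open>f\<close> than from \<open>f\<close> itself. The triangle
  inequality for squares then costs 2 + 2. A grid that carries some good approximation thus has good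
  averages.\<close>

lemma cell_average_near_best:
  assumes f: "f \<in> L2 d" and n: "n \<ge> 1"
  shows "(\<integral>x. (f x - cell_average d n f (cell d n x))\<^sup>2 \<partial>cube_measure d)
    \<le> 4 * (\<integral>x. (f x - c (cell d n x))\<^sup>2 \<partial>cube_measure d)"
proof -
  let ?h = "\<lambda>x. f x - c (cell d n x)"
  have h: "?h \<in> L2 d" by (intro L2_diff f L2_step n)
  have avg: "cell_average d n ?h q = cell_average d n f q - c q" if q: "q \<in> grid d n" for q
  proof -
    have N: "real n ^ d * (1 / real n) ^ d = 1"
      using n by (simp add: power_mult_distrib[symmetric])
    have "(\<integral>x. ?h x * indicator (cell_set d n q) x \<partial>cube_measure d)
      = (\<integral>x. f x * indicator (cell_set d n q) x - c q * (1 * indicator (cell_set d n q) x) \<partial>cube_measure d)"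
      by (rule Bochner_Integration.integral_cong) (auto simp: cell_set_def indicator_def)
    also have "\<dots> = (\<integral>x. f x * indicator (cell_set d n q) x \<partial>cube_measure d)
        - c q * (\<integral>x. 1 * indicator (cell_set d n q) x \<partial>cube_measure d)"
      using integrable_on_cell[OF L2_integrable[OF f] q n]
        integrable_on_cell[OF integrable_cube_const[of d 1] q n]
      by (simp only: Bochner_Integration.integral_diff integral_mult_right_zero integrable_mult_right)
    also have "(\<integral>x. 1 * indicator (cell_set d n q) x \<partial>cube_measure d) = (1 / n) ^ d"
      by (simp only: mult_1_left integral_indicator_cell[OF q n])
    finally show ?thesis
      unfolding cell_average_def using N by (simp only: right_diff_distrib mult.left_commute[of _ "c q"] mult_1_right)
  qed
  have "(\<integral>x. (c (cell d n x) - cell_average d n f (cell d n x))\<^sup>2 \<partial>cube_measure d)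
      = (1 / n) ^ d * (\<Sum>q\<in>grid d n. (c q - cell_average d n f q)\<^sup>2)"
    by (rule step_integral[OF n])
  also have "(\<Sum>q\<in>grid d n. (c q - cell_average d n f q)\<^sup>2) = (\<Sum>q\<in>grid d n. (cell_average d n ?h q)\<^sup>2)"
    by (rule sum.cong) (simp_all add: avg power2_commute)
  also have "(1 / n) ^ d * \<dots> \<le> (1 / n) ^ d * (real n ^ d * (\<integral>x. (?h x)\<^sup>2 \<partial>cube_measure d))"
    by (intro mult_left_mono sum_cell_average_square h n) simp
  also have "\<dots> = (\<integral>x. (?h x)\<^sup>2 \<partial>cube_measure d)"
    using n by (simp add: power_divide)
  finally show ?thesis
    using integral_square_diff_triangle[OF f L2_step[OF n, of c d] L2_step[OF n, of "cell_average d n f" d]]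
    by simp
qed

section \<open>Differences of cell averages and the weak derivative\<close>

text \<open>A smooth substitute for the indicator of cell \<open>q\<close>, to which it converges
  almost everywhere as \<open>m\<close> grows.\<close>

definition box_bump :: "nat \<Rightarrow> nat \<Rightarrow> nat \<Rightarrow> (nat \<Rightarrow> nat) \<Rightarrow> (nat \<Rightarrow> real) \<Rightarrow> real" where
  "box_bump d n m q x = (\<Prod>j<d. bump (real (q j) / n) (real (q j) / n + 1 / n) m (x j))"

lemma prod_coordinates_measurable:
  assumes "\<And>j. j < d \<Longrightarrow> smooth1 (\<psi> j)"
  shows "(\<lambda>x. \<Prod>j<d. \<psi> j (x j)) \<in> borel_measurable (cube_measure d)"
proof (rule cube_measurableI, rule borel_measurable_prod)
  fix j assume "j \<in> {..<d}"
  then have j: "j < d" by simp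
  have "\<psi> j \<in> borel_measurable borel"
    by (rule borel_measurable_continuous_onI[OF smooth1_continuous[OF assms[OF j]]])
  with coordinate_measurable[OF j] show "(\<lambda>x. \<psi> j (x j)) \<in> borel_measurable (borel_cube d)"
    by (rule measurable_compose)
qed

lemma box_bump_measurable: "box_bump d n m q \<in> borel_measurable (cube_measure d)"
  unfolding box_bump_def[abs_def] by (intro prod_coordinates_measurable smooth1_bump)

lemma box_bump_bounds: "0 \<le> box_bump d n m q x" "box_bump d n m q x \<le> 1"
  unfolding box_bump_def by (auto intro!: prod_nonneg prod_le_1 simp: bump_bounds)

text \<open>Bumps converge to indicators of open boxes, whereas cells contain lower faces; these
  faces are null.\<close>

lemma AE_coordinates_neq: "AE x in cube_measure d. \<forall>j\<in>{..<d}. x j \<noteq> a j"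
proof -
  have "AE t in unit_measure. t \<noteq> c" for c
    using AE_lborel_singleton[of c] by (subst AE_restrict_space_iff) (auto elim: eventually_mono)
  then have "AE x in borel_cube d. x j \<noteq> a j" if "j < d" for j
    using that by (intro AE_PiM_component prob_space_unit_measure) auto
  then have "AE x in borel_cube d. \<forall>j\<in>{..<d}. x j \<noteq> a j"
    by (intro AE_finite_allI) auto
  then show ?thesis unfolding cube_measure_def by (rule AE_completion)
qed

lemma box_bump_tendsto:
  assumes "q \<in> grid d n" "n \<ge> 1"
  shows "AE x in cube_measure d. (\<lambda>m. box_bump d n m q x) \<longlonglongrightarrow> indicator (cell_set d n q) x"
  using AE_coordinates_neq[of d "\<lambda>j. real (q j) / n"] AE_space[of "cube_measure d"]
proof eventually_elim
  case (elim x)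
  then have x: "x \<in> cube d" by (simp add: space_cube_measure)
  have "(\<lambda>m. box_bump d n m q x)
      \<longlonglongrightarrow> (\<Prod>j<d. indicator {real (q j) / n<..<real (q j) / n + 1 / n} (x j))"
    unfolding box_bump_def by (intro tendsto_prod bump_tendsto)
  moreover have "(\<Prod>j<d. indicator {real (q j) / n<..<real (q j) / n + 1 / n} (x j))
      = (indicator (cell_set d n q) x :: real)"
  proof (cases "x \<in> cell_set d n q")
    case True
    then have "x j \<in> {real (q j) / n..<real (q j) / n + 1 / n}" if "j < d" for j
      using that unfolding cell_set_eq[OF assms] PiE_iff by blast
    then have "x j \<in> {real (q j) / n<..<real (q j) / n + 1 / n}" if "j < d" for j
    proof -
      have "x j \<noteq> real (q j) / n" using elim(1) that by blast
      then show ?thesis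
        using \<open>\<And>j. j < d \<Longrightarrow> x j \<in> {real (q j) / n..<real (q j) / n + 1 / n}\<close>[OF that]
        unfolding greaterThanLessThan_iff atLeastLessThan_iff by linarith
    qed
    then show ?thesis using True by simp
  next
    case False
    then obtain j where "j < d" "x j \<notin> {real (q j) / n..<real (q j) / n + 1 / n}"
      using x unfolding cell_set_eq[OF assms] cube_def PiE_iff by blast
    then have "j < d" "indicator {real (q j) / n<..<real (q j) / n + 1 / n} (x j) = (0::real)"
      by (auto simp: indicator_def)
    then show ?thesis using False by (auto intro!: prod_zero)
  qed
  ultimately show ?case by simp
qed

text \<open>The test function is a tent in direction \<open>i\<close> times bumps in the other directions.\<close>

lemma cell_difference_ge_regularized:
  assumes f: "f \<in> L2 d" and g: "g \<in> L2 d" and wp: "has_weak_partial d i f g" and i: "i < d"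
    and q: "q \<in> grid d n" and Sq: "Suc (q i) < n" and m: "m > 0"
  defines "q' \<equiv> q(i := Suc (q i))"
  shows "(1 / n) * ((\<integral>x. min 0 (g x) * indicator (cell_set d n q) x \<partial>cube_measure d)
      + (\<integral>x. min 0 (g x) * indicator (cell_set d n q') x \<partial>cube_measure d))
    \<le> (\<integral>x. f x * (box_bump d n m q' x - box_bump d n m q x) \<partial>cube_measure d)"
proof -
  have n: "n \<ge> 1" using Sq by simp
  have q': "q' \<in> grid d n" unfolding q'_def by (rule grid_upd[OF q i Sq])
  define h where "h = 1 / real n"
  define a b where "a = (\<lambda>j. real (q j) / n)" and "b = (\<lambda>j. real (q j) / n + 1 / n)"
  have h: "h > 0" using n by (simp add: h_def)
  have b: "b j = a j + h" for j by (simp add: a_def b_def h_def)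
  have a0: "a j \<ge> 0" for j by (simp add: a_def)
  have b1: "b j \<le> 1" if "j < d" for j
    using grid_lt[OF q that] n by (simp add: b_def field_simps)
  have bi1: "b i + h \<le> 1" using Sq n by (simp add: b_def h_def field_simps)
  have m1: "1 / real m > 0" using m by simp
  \<comment> \<open>The tent rises across cell \<open>q\<close> and falls across cell
    \<open>q'\<close>. The margin 1/m at both ends keeps its support inside the open unit
    interval.\<close>
  obtain T where T: "smooth1 T" "deriv T = (\<lambda>t. bump (a i) (b i) m t - bump (a i + h) (b i + h) m t)"
    "\<And>t. 0 \<le> T t" "\<And>t. T t \<le> h" "\<And>t. t \<notin> {a i + 1 / m..b i + h - 1 / m} \<Longrightarrow> T t = 0"
    by (rule tent_exists[OF m h, of "a i" "b i"]) auto
  define \<psi> where "\<psi> j = (if j = i then T else bump (a j) (b j) m)" for j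
  define \<phi> where "\<phi> x = (\<Prod>j<d. \<psi> j (x j))" for x :: "nat \<Rightarrow> real"
  have sm: "smooth1 (\<psi> j)" for j by (simp add: \<psi>_def T(1) smooth1_bump)
  have supp: "\<psi> j t = 0" if "t \<notin> {a j + 1 / m..(if j = i then b i + h else b j) - 1 / m}" for j t
    using that bump_eq_0[OF m, of t "a j" "b j"] T(5)[of t] by (cases "j = i") (auto simp: \<psi>_def)
  have test: "\<phi> \<in> test_functions d"
    unfolding \<phi>_def[abs_def]
  proof (rule prod_test_function[where \<alpha> = "\<lambda>j. a j + 1 / m"
        and \<beta> = "\<lambda>j. (if j = i then b i + h else b j) - 1 / m"])
    show "0 < a j + 1 / m" for j using a0[of j] m1 by linarith
    show "(if j = i then b i + h else b j) - 1 / m < 1" if "j < d" for j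
    proof -
      have "(if j = i then b i + h else b j) \<le> 1" using b1[OF that] bi1 by simp
      then show ?thesis using m1 by linarith
    qed
  qed (rule sm supp, assumption?)+
  have part: "partial i \<phi> x = box_bump d n m q x - box_bump d n m q' x" for x
  proof -
    have bb: "box_bump d n m p x = bump (real (p i) / n) (real (p i) / n + 1 / n) m (x i)
        * (\<Prod>j\<in>{..<d} - {i}. bump (real (p j) / n) (real (p j) / n + 1 / n) m (x j))" for p
      unfolding box_bump_def using i by (intro prod.remove) auto
    have "partial i \<phi> x = (\<Prod>j<d. (\<psi>(i := deriv (\<psi> i))) j (x j))"
      unfolding \<phi>_def[abs_def] partial_prod_eq[OF i sm] ..
    also have "\<dots> = deriv T (x i) * (\<Prod>j\<in>{..<d} - {i}. (\<psi>(i := deriv (\<psi> i))) j (x j))"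
      using prod.remove[of "{..<d}" i "\<lambda>j. (\<psi>(i := deriv (\<psi> i))) j (x j)"] i by (simp add: \<psi>_def)
    also have "(\<Prod>j\<in>{..<d} - {i}. (\<psi>(i := deriv (\<psi> i))) j (x j))
        = (\<Prod>j\<in>{..<d} - {i}. bump (a j) (b j) m (x j))"
      by (rule prod.cong) (auto simp: \<psi>_def)
    finally have eq: "partial i \<phi> x = (bump (a i) (b i) m (x i) - bump (a i + h) (b i + h) m (x i))
        * (\<Prod>j\<in>{..<d} - {i}. bump (a j) (b j) m (x j))"
      unfolding T(2) .
    have "box_bump d n m q' x = bump (a i + h) (b i + h) m (x i)
        * (\<Prod>j\<in>{..<d} - {i}. bump (a j) (b j) m (x j))"
    proof -
      have "real (Suc (q i)) / n = a i + h" by (simp add: a_def h_def add_divide_distrib)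
      moreover have "(\<Prod>j\<in>{..<d} - {i}. bump (real (q' j) / n) (real (q' j) / n + 1 / n) m (x j))
          = (\<Prod>j\<in>{..<d} - {i}. bump (a j) (b j) m (x j))"
        by (rule prod.cong) (auto simp: q'_def a_def b_def)
      ultimately show ?thesis unfolding bb by (simp add: q'_def b h_def)
    qed
    moreover have "box_bump d n m q x = bump (a i) (b i) m (x i)
        * (\<Prod>j\<in>{..<d} - {i}. bump (a j) (b j) m (x j))"
      unfolding bb a_def b_def ..
    ultimately show ?thesis unfolding eq by (simp add: left_diff_distrib)
  qed
  let ?I = "\<lambda>p. indicator (cell_set d n p) :: _ \<Rightarrow> real"
  \<comment> \<open>The tent is at most \<open>h\<close> and the other factors are at most 1; the
    support meets only the two cells.\<close>
  have \<phi>_le: "0 \<le> \<phi> x \<and> \<phi> x \<le> h * (?I q x + ?I q' x)" if x: "x \<in> cube d" for x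
  proof -
    have \<psi>0: "0 \<le> \<psi> j t" for j t by (simp add: \<psi>_def T(3) bump_bounds)
    then have \<phi>0: "0 \<le> \<phi> x" by (simp add: \<phi>_def prod_nonneg)
    have "\<phi> x = T (x i) * (\<Prod>j\<in>{..<d} - {i}. \<psi> j (x j))"
      unfolding \<phi>_def using i by (subst prod.remove[of _ i]) (auto simp: \<psi>_def)
    also have "\<dots> \<le> h * 1"
    proof (rule mult_mono)
      show "(\<Prod>j\<in>{..<d} - {i}. \<psi> j (x j)) \<le> 1"
        using \<psi>0 by (intro prod_le_1) (auto simp: \<psi>_def bump_bounds)
    qed (use T(3,4) h \<psi>0 in \<open>auto intro: prod_nonneg\<close>)
    finally have \<phi>h: "\<phi> x \<le> h" by simp
    have "x \<in> cell_set d n q \<union> cell_set d n q'" if "\<phi> x \<noteq> 0"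
    proof -
      have nz: "\<psi> j (x j) \<noteq> 0" if "j < d" for j
        using \<open>\<phi> x \<noteq> 0\<close> that by (auto simp: \<phi>_def)
      have loc: "a j \<le> x j \<and> x j < (if j = i then b i + h else b j)" if "j < d" for j
      proof -
        have "x j \<in> {a j + 1 / m..(if j = i then b i + h else b j) - 1 / m}"
          using supp nz[OF that] by blast
        then show ?thesis using m1 unfolding atLeastAtMost_iff by linarith
      qed
      have x01: "x j \<in> {0<..<1}" if "j < d" for j using x that by (auto simp: cube_def PiE_iff)
      have ext: "x \<in> extensional {..<d}" using x by (auto simp: cube_def PiE_iff)
      have "x \<in> cell_set d n p" if "p \<in> grid d n" "\<And>j. j < d \<Longrightarrow> x j \<in> {real (p j) / n..<real (p j) / n + 1 / n}" for p
        unfolding cell_set_eq[OF that(1) n] PiE_iff using that(2) x01 ext by blast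
      note mem = this
      show ?thesis
      proof (cases "x i < b i")
        case True
        have "x j \<in> {real (q j) / n..<real (q j) / n + 1 / n}" if "j < d" for j
          using loc[OF that] True by (cases "j = i") (auto simp: a_def b_def)
        then show ?thesis using mem[OF q] by blast
      next
        case False
        have "x j \<in> {real (q' j) / n..<real (q' j) / n + 1 / n}" if "j < d" for j
        proof (cases "j = i")
          case True
          have "real (q' i) / n = b i" by (simp add: q'_def b_def add_divide_distrib)
          then show ?thesis using loc[OF that] False True by (simp add: h_def)
        next
          case False
          then show ?thesis using loc[OF that] by (simp add: q'_def a_def b_def)
        qed
        then show ?thesis using mem[OF q'] by blast
      qed
    qed
    then have "\<phi> x \<le> h * (?I q x + ?I q' x)"
      using \<phi>h h by (cases "\<phi> x = 0") (auto simp: indicator_def)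
    with \<phi>0 show ?thesis by blast
  qed
  have \<phi>m: "\<phi> \<in> borel_measurable (cube_measure d)"
    unfolding \<phi>_def[abs_def] by (rule prod_coordinates_measurable[OF sm])
  have gi: "integrable (cube_measure d) g" and g'i: "integrable (cube_measure d) (\<lambda>x. min 0 (g x))"
    by (intro L2_integrable g L2_min_0)+
  have \<phi>b: "\<bar>\<phi> x\<bar> \<le> 2 * h" if "x \<in> cube d" for x
  proof -
    have "h * (?I q x + ?I q' x) \<le> h * 2" using h by (intro mult_left_mono) (auto simp: indicator_def)
    then show ?thesis using \<phi>_le[OF that] by simp
  qed
  have I: "integrable (cube_measure d) (\<lambda>x. min 0 (g x) * ?I p x)" if "p \<in> grid d n" for p
    by (rule integrable_on_cell[OF g'i that n])
  have "(1 / n) * ((\<integral>x. min 0 (g x) * ?I q x \<partial>cube_measure d) + (\<integral>x. min 0 (g x) * ?I q' x \<partial>cube_measure d))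
      = (\<integral>x. h * (min 0 (g x) * ?I q x + min 0 (g x) * ?I q' x) \<partial>cube_measure d)"
    using I[OF q] I[OF q'] unfolding h_def
    by (simp only: integral_mult_right_zero Bochner_Integration.integral_add)
  also have "\<dots> \<le> (\<integral>x. g x * \<phi> x \<partial>cube_measure d)"
  proof (rule integral_mono)
    show "integrable (cube_measure d) (\<lambda>x. h * (min 0 (g x) * ?I q x + min 0 (g x) * ?I q' x))"
      using I[OF q] I[OF q'] by simp
    show "integrable (cube_measure d) (\<lambda>x. g x * \<phi> x)"
      by (rule integrable_cube_bounded[OF gi \<phi>m \<phi>b])
    fix x assume "x \<in> space (cube_measure d)"
    then have x: "x \<in> cube d" by (simp add: space_cube_measure)
    have "h * (min 0 (g x) * ?I q x + min 0 (g x) * ?I q' x) = min 0 (g x) * (h * (?I q x + ?I q' x))"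
      by (simp add: algebra_simps)
    \<comment> \<open>As \<open>min 0 (g x)\<close> is nonpositive, the upper bound on
      \<open>\<phi>\<close> becomes a lower bound for the product.\<close>
    also have "\<dots> \<le> min 0 (g x) * \<phi> x"
      using \<phi>_le[OF x] by (intro mult_left_mono_neg) auto
    also have "\<dots> \<le> g x * \<phi> x" using \<phi>_le[OF x] by (intro mult_right_mono) auto
    finally show "h * (min 0 (g x) * ?I q x + min 0 (g x) * ?I q' x) \<le> g x * \<phi> x" .
  qed
  \<comment> \<open>The minus sign of integration by parts puts the box bump of the upper cell
    \<open>q'\<close> first.\<close>
  also have "\<dots> = - (\<integral>x. f x * partial i \<phi> x \<partial>cube_measure d)"
    using wp test unfolding has_weak_partial_def by simp
  also have "\<dots> = (\<integral>x. - (f x * partial i \<phi> x) \<partial>cube_measure d)"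
    by simp
  also have "\<dots> = (\<integral>x. f x * (box_bump d n m q' x - box_bump d n m q x) \<partial>cube_measure d)"
    by (simp add: part algebra_simps)
  finally show ?thesis .
qed

text \<open>The limit of \<open>cell_difference_ge_regularized\<close> for growing \<open>m\<close>,
  dominated by \<bar>f\<bar> because box bumps lie between 0 and 1, and scaled by the reciprocal
  cell volume.\<close>

lemma cell_difference_ge:
  assumes f: "f \<in> L2 d" and g: "g \<in> L2 d" and wp: "has_weak_partial d i f g" and i: "i < d"
    and q: "q \<in> grid d n" and Sq: "Suc (q i) < n"
  defines "q' \<equiv> q(i := Suc (q i))"
  shows "(1 / n) * (cell_average d n (\<lambda>x. min 0 (g x)) q + cell_average d n (\<lambda>x. min 0 (g x)) q')
    \<le> cell_average d n f q' - cell_average d n f q"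
proof -
  have n: "n \<ge> 1" using Sq by simp
  have q': "q' \<in> grid d n" unfolding q'_def by (rule grid_upd[OF q i Sq])
  let ?I = "\<lambda>p. indicator (cell_set d n p) :: _ \<Rightarrow> real"
  let ?G = "\<lambda>p. \<integral>x. min 0 (g x) * ?I p x \<partial>cube_measure d"
  have fi: "integrable (cube_measure d) f" by (rule L2_integrable[OF f])
  have fm: "f \<in> borel_measurable (cube_measure d)" by (rule L2_measurable[OF f])
  have Im: "?I p \<in> borel_measurable (cube_measure d)" if "p \<in> grid d n" for p
    using cell_set_measurable_cube[OF that n] by (rule borel_measurable_indicator)
  have "(\<lambda>m. \<integral>x. f x * (box_bump d n m q' x - box_bump d n m q x) \<partial>cube_measure d)
      \<longlonglongrightarrow> (\<integral>x. f x * (?I q' x - ?I q x) \<partial>cube_measure d)"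
  proof (rule integral_dominated_convergence[where w = "\<lambda>x. \<bar>f x\<bar>"])
    show "(\<lambda>x. f x * (?I q' x - ?I q x)) \<in> borel_measurable (cube_measure d)"
      by (intro borel_measurable_times borel_measurable_diff fm Im q q')
    show "(\<lambda>x. f x * (box_bump d n m q' x - box_bump d n m q x)) \<in> borel_measurable (cube_measure d)" for m
      by (intro borel_measurable_times borel_measurable_diff fm box_bump_measurable)
    show "integrable (cube_measure d) (\<lambda>x. \<bar>f x\<bar>)" using fi by (rule integrable_abs)
    show "AE x in cube_measure d. (\<lambda>m. f x * (box_bump d n m q' x - box_bump d n m q x))
        \<longlonglongrightarrow> f x * (?I q' x - ?I q x)"
      using box_bump_tendsto[OF q n] box_bump_tendsto[OF q' n]
      by eventually_elim (intro tendsto_intros)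
    show "AE x in cube_measure d. norm (f x * (box_bump d n m q' x - box_bump d n m q x)) \<le> \<bar>f x\<bar>" for m
    proof (rule AE_I2)
      fix x
      have "\<bar>box_bump d n m q' x - box_bump d n m q x\<bar> \<le> 1"
        using box_bump_bounds[of d n m q x] box_bump_bounds[of d n m q' x] by linarith
      then show "norm (f x * (box_bump d n m q' x - box_bump d n m q x)) \<le> \<bar>f x\<bar>"
        by (simp add: abs_mult mult_left_le)
    qed
  qed
  then have "(1 / n) * (?G q + ?G q') \<le> (\<integral>x. f x * (?I q' x - ?I q x) \<partial>cube_measure d)"
  proof (rule LIMSEQ_le_const)
    show "\<exists>N. \<forall>m\<ge>N. (1 / n) * (?G q + ?G q')
        \<le> (\<integral>x. f x * (box_bump d n m q' x - box_bump d n m q x) \<partial>cube_measure d)"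
      using cell_difference_ge_regularized[OF f g wp i q Sq] unfolding q'_def
      by (intro exI[of _ 1]) auto
  qed
  also have "\<dots> = (\<integral>x. f x * ?I q' x - f x * ?I q x \<partial>cube_measure d)"
    by (simp only: right_diff_distrib)
  also have "\<dots> = (\<integral>x. f x * ?I q' x \<partial>cube_measure d) - (\<integral>x. f x * ?I q x \<partial>cube_measure d)"
    by (intro Bochner_Integration.integral_diff integrable_on_cell fi q q' n)
  finally have "real n ^ d * ((1 / n) * (?G q + ?G q'))
      \<le> real n ^ d * ((\<integral>x. f x * ?I q' x \<partial>cube_measure d) - (\<integral>x. f x * ?I q x \<partial>cube_measure d))"
    by (rule mult_left_mono) simp
  then show ?thesis unfolding cell_average_def
    by (simp only: right_diff_distrib distrib_left mult.left_commute)
qed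

text \<open>The factor \<open>(real n)\<^sup>2\<close> cancels the 1/n in
  \<open>cell_difference_ge\<close>. One 2 in the constant comes from squaring a sum, the other from
  counting a cell as the lower and as the upper one of a pair; \<open>real n ^ d\<close> comes from
  \<open>sum_cell_average_square\<close>.\<close>

lemma energy_cell_average:
  assumes f: "f \<in> L2 d" and n: "n \<ge> 1"
    and g: "\<And>i. i < d \<Longrightarrow> g i \<in> L2 d \<and> has_weak_partial d i f (g i)"
  shows "(real n)\<^sup>2 * energy d n (cell_average d n f)
    \<le> 4 * real n ^ d * (\<Sum>i<d. \<integral>x. (min 0 (g i x))\<^sup>2 \<partial>cube_measure d)"
proof -
  define F where "F = cell_average d n f"
  have dir: "(real n)\<^sup>2 * (\<Sum>q\<in>grid d n. (vio n i F q)\<^sup>2)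
      \<le> 4 * real n ^ d * (\<integral>x. (min 0 (g i x))\<^sup>2 \<partial>cube_measure d)" if i: "i < d" for i
  proof -
    define G where "G = cell_average d n (\<lambda>x. min 0 (g i x))"
    have gi: "g i \<in> L2 d" "has_weak_partial d i f (g i)" using g[OF i] by auto
    have G0: "G q \<le> 0" for q
    proof -
      have "0 \<le> (\<integral>x. - (min 0 (g i x) * indicator (cell_set d n q) x) \<partial>cube_measure d)"
        by (rule Bochner_Integration.integral_nonneg) (auto simp: indicator_def)
      then show ?thesis by (simp add: G_def cell_average_def mult_nonneg_nonpos)
    qed
    let ?U = "{q \<in> grid d n. Suc (q i) < n}"
    have vio_le: "(real n)\<^sup>2 * (vio n i F q)\<^sup>2 \<le> 2 * (G q)\<^sup>2 + 2 * (G (q(i := Suc (q i))))\<^sup>2" if q: "q \<in> ?U" for q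
    proof -
      let ?q = "q(i := Suc (q i))"
      have "(1 / n) * (G q + G ?q) \<le> F ?q - F q"
        using cell_difference_ge[OF f gi i, of q n] q by (simp add: F_def G_def)
      moreover have "(1 / n) * (G q + G ?q) \<le> 0"
        using G0[of q] G0[of ?q] by (intro mult_nonneg_nonpos) auto
      \<comment> \<open>A nonpositive lower bound survives the truncation by
        \<open>min 0\<close>.\<close>
      ultimately have "(1 / n) * (G q + G ?q) \<le> vio n i F q" using q by (simp add: vio_def fwd_def)
      then have "real n * ((1 / n) * (G q + G ?q)) \<le> real n * vio n i F q" by (rule mult_left_mono) simp
      then have "G q + G ?q \<le> real n * vio n i F q" using n by simp
      moreover have "real n * vio n i F q \<le> 0" by (intro mult_nonneg_nonpos) (auto simp: vio_def)
      ultimately have "\<bar>real n * vio n i F q\<bar> \<le> \<bar>G q + G ?q\<bar>" by linarith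
      then have "(real n * vio n i F q)\<^sup>2 \<le> (G q + G ?q)\<^sup>2" by (simp only: abs_le_square_iff)
      also have "\<dots> \<le> 2 * (G q)\<^sup>2 + 2 * (G ?q)\<^sup>2"
      proof -
        have "0 \<le> (G q - G ?q)\<^sup>2" by simp
        then show ?thesis by (simp only: power2_sum power2_diff)
      qed
      finally show ?thesis by (simp add: power_mult_distrib)
    qed
    have shift: "(\<Sum>q\<in>?U. (G (q(i := Suc (q i))))\<^sup>2) \<le> (\<Sum>q\<in>grid d n. (G q)\<^sup>2)"
    proof (rule sum_le_included[where i = "\<lambda>q. q(i := q i - 1)"])
      show "\<forall>q\<in>?U. \<exists>p\<in>grid d n. p(i := p i - 1) = q \<and> (G (q(i := Suc (q i))))\<^sup>2 \<le> (G p)\<^sup>2"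
      proof
        fix q assume "q \<in> ?U"
        then have "q(i := Suc (q i)) \<in> grid d n" using grid_upd[OF _ i] by blast
        then show "\<exists>p\<in>grid d n. p(i := p i - 1) = q \<and> (G (q(i := Suc (q i))))\<^sup>2 \<le> (G p)\<^sup>2"
          by (intro bexI[of _ "q(i := Suc (q i))"]) auto
      qed
    qed auto
    have "(\<Sum>q\<in>grid d n. (vio n i F q)\<^sup>2) = (\<Sum>q\<in>?U. (vio n i F q)\<^sup>2)"
      by (rule sum.mono_neutral_right) (auto simp: vio_boundary)
    then have "(real n)\<^sup>2 * (\<Sum>q\<in>grid d n. (vio n i F q)\<^sup>2) = (\<Sum>q\<in>?U. (real n)\<^sup>2 * (vio n i F q)\<^sup>2)"
      by (simp only: sum_distrib_left)
    also have "\<dots> \<le> (\<Sum>q\<in>?U. 2 * (G q)\<^sup>2 + 2 * (G (q(i := Suc (q i))))\<^sup>2)"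
      by (rule sum_mono) (rule vio_le)
    also have "\<dots> = 2 * (\<Sum>q\<in>?U. (G q)\<^sup>2) + 2 * (\<Sum>q\<in>?U. (G (q(i := Suc (q i))))\<^sup>2)"
      by (simp only: sum.distrib sum_distrib_left)
    also have "\<dots> \<le> 2 * (\<Sum>q\<in>grid d n. (G q)\<^sup>2) + 2 * (\<Sum>q\<in>grid d n. (G q)\<^sup>2)"
    proof -
      have "(\<Sum>q\<in>?U. (G q)\<^sup>2) \<le> (\<Sum>q\<in>grid d n. (G q)\<^sup>2)" by (rule sum_mono2) auto
      then show ?thesis using shift by linarith
    qed
    also have "\<dots> \<le> 4 * (real n ^ d * (\<integral>x. (min 0 (g i x))\<^sup>2 \<partial>cube_measure d))"
      using sum_cell_average_square[OF L2_min_0[OF gi(1)] n] unfolding G_def by linarith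
    finally show ?thesis by (simp only: mult.assoc)
  qed
  have "(real n)\<^sup>2 * energy d n F = (\<Sum>i<d. (real n)\<^sup>2 * (\<Sum>q\<in>grid d n. (vio n i F q)\<^sup>2))"
    unfolding energy_def by (rule sum_distrib_left)
  also have "\<dots> \<le> (\<Sum>i<d. 4 * real n ^ d * (\<integral>x. (min 0 (g i x))\<^sup>2 \<partial>cube_measure d))"
    by (rule sum_mono) (simp only: lessThan_iff dir)
  finally show ?thesis unfolding F_def by (simp only: sum_distrib_left)
qed

section \<open>Passage from the grid to the cube\<close>

lemma cell_mono:
  assumes "x \<le> y" shows "cell d n x \<le> cell d n y"
proof (rule le_funI)
  fix j
  have "real n * x j \<le> real n * y j" using assms by (intro mult_left_mono) (auto simp: le_fun_def)
  then show "cell d n x j \<le> cell d n y j" by (auto simp: cell_def intro: nat_mono floor_mono)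
qed

lemma step_monotone_L2:
  assumes n: "n \<ge> 1" and u: "energy d n u = 0"
  shows "(\<lambda>x. u (cell d n x)) \<in> monotone_L2 d"
proof -
  have "mono_on (cube d) (\<lambda>x. u (cell d n x))"
    by (intro mono_onI energy_zero_imp_mono[OF u] cell_in_grid cell_mono n)
  then show ?thesis using L2_step[OF n] by (auto simp: monotone_L2_def)
qed

text \<open>The infimum is over a set that is nonempty through \<open>g\<close> and bounded below by
  0, so it is nonnegative and the inequality may be squared.\<close>

lemma dist_mono_le:
  assumes g: "g \<in> monotone_L2 d"
  shows "(dist_mono d f)\<^sup>2 \<le> (\<integral>x. (f x - g x)\<^sup>2 \<partial>cube_measure d)"
proof -
  have N0: "0 \<le> L2_norm d h" for h by (simp add: L2_norm_def)
  have "dist_mono d f \<le> L2_norm d (\<lambda>x. f x - g x)"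
    unfolding dist_mono_def by (rule cINF_lower[OF _ g]) (auto intro!: bdd_belowI[of _ 0] N0)
  moreover have "0 \<le> dist_mono d f"
    unfolding dist_mono_def using g by (intro cINF_greatest) (auto intro: N0)
  ultimately have "(dist_mono d f)\<^sup>2 \<le> (L2_norm d (\<lambda>x. f x - g x))\<^sup>2" by (rule power_mono)
  then show ?thesis by (simp add: L2_norm_def)
qed

text \<open>The grid inequality is applied to cell averages close to \<open>f\<close>. The weak
  derivatives are arbitrary here, so any choice of representatives is covered. The constant is 2 * 4
  * 4, from the triangle inequality, \<open>discrete_dist\<close> and
  \<open>energy_cell_average\<close>.\<close>

lemma directed_poincare:
  assumes f: "f \<in> L2 d" and g: "\<And>i. i < d \<Longrightarrow> g i \<in> L2 d \<and> has_weak_partial d i f (g i)"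
  shows "(dist_mono d f)\<^sup>2 \<le> 32 * (\<Sum>i<d. \<integral>x. (min 0 (g i x))\<^sup>2 \<partial>cube_measure d)"
    (is "_ \<le> 32 * ?E")
proof (rule field_le_epsilon)
  fix \<epsilon> :: real assume "\<epsilon> > 0"
  \<comment> \<open>The tolerance grows by 4 in \<open>cell_average_near_best\<close> and by 2 in
    the triangle inequality.\<close>
  then have "\<epsilon> / 8 > 0" by simp
  then obtain n c where n: "n \<ge> 1"
    and c: "(\<integral>x. (f x - c (cell d n x))\<^sup>2 \<partial>cube_measure d) < \<epsilon> / 8"
    by (rule L2_step_dense[OF f])
  define F where "F = cell_average d n f"
  have fF: "(\<integral>x. (f x - F (cell d n x))\<^sup>2 \<partial>cube_measure d) \<le> \<epsilon> / 2"
    using cell_average_near_best[OF f n, of c] c unfolding F_def by linarith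
  obtain u where u: "energy d n u = 0"
    "(\<Sum>q\<in>grid d n. (u q - F q)\<^sup>2) \<le> 4 * (real n)\<^sup>2 * energy d n F"
    using discrete_dist[OF n] by blast
  have N: "(1 / real n) ^ d * real n ^ d = 1"
    using n by (simp add: power_mult_distrib[symmetric])
  have "(\<integral>x. (F (cell d n x) - u (cell d n x))\<^sup>2 \<partial>cube_measure d)
      = (1 / n) ^ d * (\<Sum>q\<in>grid d n. (F q - u q)\<^sup>2)"
    by (rule step_integral[OF n])
  also have "\<dots> = (1 / n) ^ d * (\<Sum>q\<in>grid d n. (u q - F q)\<^sup>2)"
    by (simp only: power2_commute)
  also have "\<dots> \<le> (1 / n) ^ d * (4 * (4 * real n ^ d * ?E))"
  proof (rule mult_left_mono)
    show "(\<Sum>q\<in>grid d n. (u q - F q)\<^sup>2) \<le> 4 * (4 * real n ^ d * ?E)"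
      using u(2) energy_cell_average[OF f n g] unfolding F_def by linarith
  qed simp
  also have "\<dots> = ((1 / n) ^ d * real n ^ d) * (16 * ?E)" by simp
  finally have Fu: "(\<integral>x. (F (cell d n x) - u (cell d n x))\<^sup>2 \<partial>cube_measure d) \<le> 16 * ?E"
    unfolding N by simp
  have "(dist_mono d f)\<^sup>2 \<le> (\<integral>x. (f x - u (cell d n x))\<^sup>2 \<partial>cube_measure d)"
    by (rule dist_mono_le[OF step_monotone_L2[OF n u(1)]])
  also have "\<dots> \<le> 2 * (\<integral>x. (f x - F (cell d n x))\<^sup>2 \<partial>cube_measure d)
      + 2 * (\<integral>x. (F (cell d n x) - u (cell d n x))\<^sup>2 \<partial>cube_measure d)"
    by (rule integral_square_diff_triangle[OF f L2_step[OF n] L2_step[OF n]])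
  also have "\<dots> \<le> 32 * ?E + \<epsilon>" using fF Fu by linarith
  finally show "(dist_mono d f)\<^sup>2 \<le> 32 * ?E + \<epsilon>" .
qed

theorem theorem1p1:
  "\<exists>C::real. C > 0 \<and>
     (\<forall>d::nat. \<forall>f \<in> H1 d.
        (dist_mono d f)\<^sup>2
          \<le> C * (\<integral>x. (L2_set (directed_gradient d f x) {..<d})\<^sup>2 \<partial>cube_measure d))"
proof (intro exI[of _ 32] conjI allI ballI)
  fix d f assume f: "f \<in> H1 d"
  \<comment> \<open>Membership in \<open>H1\<close> supplies the witness for the choice operator in
    \<open>weak_partial\<close>.\<close>
  have g: "weak_partial d i f \<in> L2 d \<and> has_weak_partial d i f (weak_partial d i f)" if "i < d" for i
  proof -
    have "\<exists>g. g \<in> L2 d \<and> has_weak_partial d i f g" using f that unfolding H1_def by blast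
    then show ?thesis unfolding weak_partial_def by (rule someI_ex)
  qed
  have "(\<integral>x. (L2_set (directed_gradient d f x) {..<d})\<^sup>2 \<partial>cube_measure d)
      = (\<integral>x. (\<Sum>i<d. (min 0 (weak_partial d i f x))\<^sup>2) \<partial>cube_measure d)"
    by (simp add: L2_set_def sum_nonneg directed_gradient_def)
  also have "\<dots> = (\<Sum>i<d. \<integral>x. (min 0 (weak_partial d i f x))\<^sup>2 \<partial>cube_measure d)"
    by (intro Bochner_Integration.integral_sum L2_square_integrable L2_min_0) (use g in auto)
  finally show "(dist_mono d f)\<^sup>2
      \<le> 32 * (\<integral>x. (L2_set (directed_gradient d f x) {..<d})\<^sup>2 \<partial>cube_measure d)"
    using directed_poincare[of f d "\<lambda>i. weak_partial d i f", OF _ g] f by (simp add: H1_def)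
qed simp

end
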